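(* Let $Y$ be a skew Young diagram with $N$ boxes. (a) For any admissible reading $\psi:B(Y)\to\mathbf B^{\otimes N}$ of $Y$, the image $\psi(B(Y))$ is stable under the operators $\tilde e_i$ and $\tilde f_i$ for all $i\in I$ (i.e. $\tilde e_i\psi(T),\tilde f_i\psi(T)\in\psi(B(Y))\sqcup\{0\}$ for every $T\in B(Y)$); hence an admissible reading induces a crystal structure on $B(Y)$. (b) The induced crystal structure on $B(Y)$ does not depend on the choice of the admissible reading.
   Context: Fix integers $m,n\ge1$. $I=\{\overline{m-1},\dots,\overline1,0,1,\dots,n-1\}$. $\mathbf B=\mathbf B_+\sqcup\mathbf B_-$, $\mathbf B_+=\{\overline m,\dots,\overline1\}$, $\mathbf B_-=\{1,\dots,n\}$, ordered by $\overline m<\overline{m-1}<\dots<\overline1<1<2<\dots<n$; $P=\bigoplus_{b\in\mathbf B}\mathbb Z\epsilon_b$. $\mathbf B$ is a crystal with $\mathrm{wt}(b)=\epsilon_b$ and $\tilde f_ib=b'$ (equivalently $\tilde e_ib'=b$) exactly for $(i,b,b')=(\overline k,\overline{k+1},\overline k)$ ($1\le k\le m-1$), $(0,\overline1,1)$, $(k,k,k+1)$ ($1\le k\le n-1$); all other values are $0$. For an element $b$ of a crystal put $\varepsilon_i(b)=\max\{r\ge0:\tilde e_i^rb\ne0\}$, $\varphi_i(b)=\max\{r\ge0:\tilde f_i^rb\ne0\}$. The tensor product of crystals has weights $\mathrm{wt}(b_1\otimes b_2)=\mathrm{wt}(b_1)+\mathrm{wt}(b_2)$ and operators (with $0\otimes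 b=b\otimes 0=0$): - $i=\overline k$: $\tilde e_i(b_1\otimes b_2)=\tilde e_ib_1\otimes b_2$ if $\varphi_i(b_1)\ge\varepsilon_i(b_2)$, else $b_1\otimes\tilde e_ib_2$; $\tilde f_i(b_1\otimes b_2)=\tilde f_ib_1\otimes b_2$ if $\varphi_i(b_1)>\varepsilon_i(b_2)$, else $b_1\otimes\tilde f_ib_2$. - $i\in\{1,\dots,n-1\}$: $\tilde e_i(b_1\otimes b_2)=b_1\otimes\tilde e_ib_2$ if $\varphi_i(b_2)\ge\varepsilon_i(b_1)$, else $\tilde e_ib_1\otimes b_2$; $\tilde f_i(b_1\otimes b_2)=b_1\otimes\tilde f_ib_2$ if $\varphi_i(b_2)>\varepsilon_i(b_1)$, else $\tilde f_ib_1\otimes b_2$. - $i=0$: with $\langle h_0,\sum_b\lambda_b\epsilon_b\rangle=\lambda_{\overline1}+\lambda_1$, the operators $\tilde e_0,\tilde f_0$ act on the first factor if $\langle h_0,\mathrm{wt}(b_1)\rangle>0$, and on the second factor if $\langle h_0,\mathrm{wt}(b_1)\rangle=0$. This tensor product is associative and gives the crystal $\mathbf B^{\otimes N}$ (the crystal of the $N$-th tensor power of the vector representation of $U_q(\mathfrak{gl}(m,n))$; signs are disregarded). A skew Young diagram is obtained by removing a Young diagram from a larger Young diagram containing it. A semistandard tableau of shape $Y$ is a filling of the boxes of $Y$ with elements of $\mathbf B$ such that entries are weakly increasing along each row from left to right, with only elements of $\mathbf B_+$ allowed to repeat in a row, and weakly increasing down each column, with only elements of $\mathbf B_-$ allowed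 to repeat in a column. $B(Y)$ is the set of semistandard tableaux of shape $Y$. A reading is the embedding $B(Y)\to\mathbf B^{\otimes N}$ attached to a listing of the boxes of $Y$: a tableau with entry $b_r$ in the $r$-th listed box is sent to $b_1\otimes\dots\otimes b_N$. A box in row $i$ (from the top), column $j$ (from the left) is strictly higher than a different box in row $i'$, column $j'$ if $i\le i'$ and $j\ge j'$. A reading is admissible if a box $\beta$ is read before a box $\beta'$ whenever $\beta$ is strictly higher than $\beta'$. *)

theory Defs
  imports Main "HOL-Library.FuncSet"
begin

text \<open>\<open>Bar k\<close> is the letter \<open>k\<close> with a bar, \<open>Pos k\<close> the letter \<open>k\<close> without one.
  The set \<open>B\<close> for \<open>gl(m,n)\<close> is the finite subset \<open>letters m n\<close>.\<close>

datatype letter = Bar nat | Pos nat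

instantiation letter :: linorder
begin

fun less_eq_letter :: "letter \<Rightarrow> letter \<Rightarrow> bool" where
  "Bar j \<le> Bar k \<longleftrightarrow> k \<le> j"
| "Bar j \<le> Pos k \<longleftrightarrow> True"
| "Pos j \<le> Bar k \<longleftrightarrow> False"
| "Pos j \<le> Pos k \<longleftrightarrow> j \<le> k"

definition less_letter :: "letter \<Rightarrow> letter \<Rightarrow> bool" where
  "less_letter x y \<longleftrightarrow> x \<le> y \<and> \<not> y \<le> x"

instance
proof
  fix x y z :: letter
  show "x < y \<longleftrightarrow> x \<le> y \<and> \<not> y \<le> x"
    by (rule less_letter_def)
  show "x \<le> x"
    by (cases x) auto
  show "x \<le> y \<Longrightarrow> y \<le> z \<Longrightarrow> x \<le> z"
    by (cases x; cases y; cases z) auto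
  show "x \<le> y \<Longrightarrow> y \<le> x \<Longrightarrow> x = y"
    by (cases x; cases y) auto
  show "x \<le> y \<or> y \<le> x"
    by (cases x; cases y) auto
qed

end

definition letters_plus :: "nat \<Rightarrow> letter set" where
  "letters_plus m = Bar ` {1..m}"

definition letters_minus :: "nat \<Rightarrow> letter set" where
  "letters_minus n = Pos ` {1..n}"

definition letters :: "nat \<Rightarrow> nat \<Rightarrow> letter set" where
  "letters m n = letters_plus m \<union> letters_minus n"

datatype index = IBar nat | IZero | IPos nat

definition indices :: "nat \<Rightarrow> nat \<Rightarrow> index set" where
  "indices m n = IBar ` {1..<m} \<union> {IZero} \<union> IPos ` {1..<n}"

text \<open>Weights are integer-valued functions on letters; the lattice \<open>P\<close> consists of those
  supported on \<open>letters m n\<close>.\<close>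

type_synonym weight = "letter \<Rightarrow> int"

definition weight_lattice :: "nat \<Rightarrow> nat \<Rightarrow> weight set" where
  "weight_lattice m n = {l. \<forall>b. b \<notin> letters m n \<longrightarrow> l b = 0}"

definition eps :: "letter \<Rightarrow> weight" where
  "eps b = (\<lambda>c. if c = b then 1 else 0)"

fun root :: "index \<Rightarrow> weight" where
  "root (IBar k) = (\<lambda>c. eps (Bar (Suc k)) c - eps (Bar k) c)"
| "root IZero = (\<lambda>c. eps (Bar 1) c - eps (Pos 1) c)"
| "root (IPos k) = (\<lambda>c. eps (Pos k) c - eps (Pos (Suc k)) c)"

fun pairing :: "index \<Rightarrow> weight \<Rightarrow> int" where
  "pairing (IBar k) l = l (Bar (Suc k)) - l (Bar k)"
| "pairing IZero l = l (Bar 1) + l (Pos 1)"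
| "pairing (IPos k) l = l (Pos k) - l (Pos (Suc k))"

text \<open>Crystal data. The formal element \<open>0\<close> is \<open>None\<close>.\<close>

record 'a crystal =
  elts :: "'a set"
  wt :: "'a \<Rightarrow> weight"
  etil :: "index \<Rightarrow> 'a \<Rightarrow> 'a option"
  ftil :: "index \<Rightarrow> 'a \<Rightarrow> 'a option"

definition iter :: "('a \<Rightarrow> 'a option) \<Rightarrow> nat \<Rightarrow> 'a \<Rightarrow> 'a option" where
  "iter g r b = ((\<lambda>x. Option.bind x g) ^^ r) (Some b)"

definition epsilon :: "'a crystal \<Rightarrow> index \<Rightarrow> 'a \<Rightarrow> nat" where
  "epsilon C i b = Max {r. iter (etil C i) r b \<noteq> None}"

definition phi :: "'a crystal \<Rightarrow> index \<Rightarrow> 'a \<Rightarrow> nat" where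
  "phi C i b = Max {r. iter (ftil C i) r b \<noteq> None}"

text \<open>\<open>root i\<close> and \<open>pairing i\<close> are the simple root and the pairing with the simple coroot
  \<open>h\<^sub>i\<close>. Besides the usual axioms of a seminormal crystal, the pairing with the coroot of the odd
  index \<open>0\<close> is required to be nonnegative: the tensor product rule at \<open>0\<close> covers no other case.\<close>

definition is_crystal :: "nat \<Rightarrow> nat \<Rightarrow> 'a crystal \<Rightarrow> bool" where
  "is_crystal m n C \<longleftrightarrow>
     (\<forall>b \<in> elts C. wt C b \<in> weight_lattice m n \<and> 0 \<le> pairing IZero (wt C b)) \<and>
     (\<forall>i \<in> indices m n. \<forall>b \<in> elts C.
        set_option (etil C i b) \<subseteq> elts C \<and> set_option (ftil C i b) \<subseteq> elts C \<and>
        finite {r. iter (etil C i) r b \<noteq> None} \<and> finite {r. iter (ftil C i) r b \<noteq> None} \<and>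
        (i \<noteq> IZero \<longrightarrow> int (phi C i b) - int (epsilon C i b) = pairing i (wt C b))) \<and>
     (\<forall>i \<in> indices m n. \<forall>b \<in> elts C. \<forall>b' \<in> elts C.
        (ftil C i b = Some b' \<longleftrightarrow> etil C i b' = Some b) \<and>
        (ftil C i b = Some b' \<longrightarrow> wt C b' = (\<lambda>c. wt C b c - root i c)))"

fun vector_f :: "nat \<Rightarrow> nat \<Rightarrow> index \<Rightarrow> letter \<Rightarrow> letter option" where
  "vector_f m n (IBar k) b = (if 1 \<le> k \<and> k < m \<and> b = Bar (Suc k) then Some (Bar k) else None)"
| "vector_f m n IZero b = (if b = Bar 1 then Some (Pos 1) else None)"
| "vector_f m n (IPos k) b = (if 1 \<le> k \<and> k < n \<and> b = Pos k then Some (Pos (Suc k)) else None)"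

fun vector_e :: "nat \<Rightarrow> nat \<Rightarrow> index \<Rightarrow> letter \<Rightarrow> letter option" where
  "vector_e m n (IBar k) b = (if 1 \<le> k \<and> k < m \<and> b = Bar k then Some (Bar (Suc k)) else None)"
| "vector_e m n IZero b = (if b = Pos 1 then Some (Bar 1) else None)"
| "vector_e m n (IPos k) b = (if 1 \<le> k \<and> k < n \<and> b = Pos (Suc k) then Some (Pos k) else None)"

definition vector_crystal :: "nat \<Rightarrow> nat \<Rightarrow> letter crystal" where
  "vector_crystal m n =
     \<lparr>elts = letters m n, wt = eps, etil = vector_e m n, ftil = vector_f m n\<rparr>"

definition on_fst :: "('a \<Rightarrow> 'a option) \<Rightarrow> 'a \<times> 'b \<Rightarrow> ('a \<times> 'b) option" where
  "on_fst g = (\<lambda>(x, y). map_option (\<lambda>x'. (x', y)) (g x))"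

definition on_snd :: "('b \<Rightarrow> 'b option) \<Rightarrow> 'a \<times> 'b \<Rightarrow> ('a \<times> 'b) option" where
  "on_snd g = (\<lambda>(x, y). map_option (\<lambda>y'. (x, y')) (g y))"

text \<open>For the index \<open>0\<close> the two cases of the tensor product rule are
  \<open>pairing IZero (wt C x) > 0\<close> and \<open>= 0\<close>; the pairing is never negative on a crystal
  (see \<open>is_crystal\<close>).\<close>

fun tensor_e :: "'a crystal \<Rightarrow> 'b crystal \<Rightarrow> index \<Rightarrow> 'a \<times> 'b \<Rightarrow> ('a \<times> 'b) option" where
  "tensor_e C D (IBar k) (x, y) =
     (if phi C (IBar k) x \<ge> epsilon D (IBar k) y
      then on_fst (etil C (IBar k)) (x, y) else on_snd (etil D (IBar k)) (x, y))"
| "tensor_e C D IZero (x, y) =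
     (if pairing IZero (wt C x) > 0
      then on_fst (etil C IZero) (x, y) else on_snd (etil D IZero) (x, y))"
| "tensor_e C D (IPos k) (x, y) =
     (if phi D (IPos k) y \<ge> epsilon C (IPos k) x
      then on_snd (etil D (IPos k)) (x, y) else on_fst (etil C (IPos k)) (x, y))"

fun tensor_f :: "'a crystal \<Rightarrow> 'b crystal \<Rightarrow> index \<Rightarrow> 'a \<times> 'b \<Rightarrow> ('a \<times> 'b) option" where
  "tensor_f C D (IBar k) (x, y) =
     (if phi C (IBar k) x > epsilon D (IBar k) y
      then on_fst (ftil C (IBar k)) (x, y) else on_snd (ftil D (IBar k)) (x, y))"
| "tensor_f C D IZero (x, y) =
     (if pairing IZero (wt C x) > 0
      then on_fst (ftil C IZero) (x, y) else on_snd (ftil D IZero) (x, y))"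
| "tensor_f C D (IPos k) (x, y) =
     (if phi D (IPos k) y > epsilon C (IPos k) x
      then on_snd (ftil D (IPos k)) (x, y) else on_fst (ftil C (IPos k)) (x, y))"

definition tensor :: "'a crystal \<Rightarrow> 'b crystal \<Rightarrow> ('a \<times> 'b) crystal" where
  "tensor C D =
     \<lparr>elts = elts C \<times> elts D,
      wt = (\<lambda>(x, y) c. wt C x c + wt D y c),
      etil = tensor_e C D,
      ftil = tensor_f C D\<rparr>"

text \<open>The \<open>N\<close>-th tensor power, bracketed to the right, on words of length \<open>N\<close>: the word
  \<open>b # w\<close> stands for the tensor product of \<open>b\<close> and \<open>w\<close>. The \<open>0\<close>-th power is the unit crystal,
  with one element of weight \<open>0\<close> killed by all operators; tensoring a letter with it changes
  nothing.\<close>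

primrec tensor_power :: "nat \<Rightarrow> nat \<Rightarrow> nat \<Rightarrow> letter list crystal" where
  "tensor_power m n 0 =
     \<lparr>elts = {[]}, wt = (\<lambda>_ _. 0), etil = (\<lambda>_ _. None), ftil = (\<lambda>_ _. None)\<rparr>"
| "tensor_power m n (Suc N) =
     (let C = tensor (vector_crystal m n) (tensor_power m n N) in
      \<lparr>elts = (\<lambda>(b, w). b # w) ` elts C,
       wt = (\<lambda>w. wt C (hd w, tl w)),
       etil = (\<lambda>i w. map_option (\<lambda>(b, v). b # v) (etil C i (hd w, tl w))),
       ftil = (\<lambda>i w. map_option (\<lambda>(b, v). b # v) (ftil C i (hd w, tl w)))\<rparr>)"

definition stable :: "nat \<Rightarrow> nat \<Rightarrow> 'a crystal \<Rightarrow> 'a set \<Rightarrow> bool" where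
  "stable m n C S \<longleftrightarrow>
     (\<forall>x \<in> S. \<forall>i \<in> indices m n.
        set_option (etil C i x) \<subseteq> S \<and> set_option (ftil C i x) \<subseteq> S)"

text \<open>Transport of crystal data along \<open>\<psi>\<close>, meaningful when \<open>\<psi>\<close> is injective on \<open>A\<close> with stable
  image.\<close>

definition induced_crystal :: "'a set \<Rightarrow> ('a \<Rightarrow> 'b) \<Rightarrow> 'b crystal \<Rightarrow> 'a crystal" where
  "induced_crystal A \<psi> C =
     \<lparr>elts = A,
      wt = (\<lambda>a. wt C (\<psi> a)),
      etil = (\<lambda>i a. map_option (inv_into A \<psi>) (etil C i (\<psi> a))),
      ftil = (\<lambda>i a. map_option (inv_into A \<psi>) (ftil C i (\<psi> a)))\<rparr>"

text \<open>A box is a pair (row from the top, column from the left), both counted from \<open>0\<close>.\<close>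

type_synonym box = "nat \<times> nat"

definition young_diagram :: "box set \<Rightarrow> bool" where
  "young_diagram D \<longleftrightarrow>
     finite D \<and> (\<forall>i j i' j'. (i, j) \<in> D \<and> i' \<le> i \<and> j' \<le> j \<longrightarrow> (i', j') \<in> D)"

definition skew_young_diagram :: "box set \<Rightarrow> bool" where
  "skew_young_diagram Y \<longleftrightarrow>
     (\<exists>D E. young_diagram D \<and> young_diagram E \<and> E \<subseteq> D \<and> Y = D - E)"

type_synonym tableau = "box \<Rightarrow> letter"

definition semistandard_tableaux :: "nat \<Rightarrow> nat \<Rightarrow> box set \<Rightarrow> tableau set" where
  "semistandard_tableaux m n Y =
     {T \<in> Y \<rightarrow>\<^sub>E letters m n.
        (\<forall>i j j'. (i, j) \<in> Y \<and> (i, j') \<in> Y \<and> j < j' \<longrightarrow>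
           T (i, j) \<le> T (i, j') \<and> (T (i, j) = T (i, j') \<longrightarrow> T (i, j) \<in> letters_plus m)) \<and>
        (\<forall>i i' j. (i, j) \<in> Y \<and> (i', j) \<in> Y \<and> i < i' \<longrightarrow>
           T (i, j) \<le> T (i', j) \<and> (T (i, j) = T (i', j) \<longrightarrow> T (i, j) \<in> letters_minus n))}"

fun strictly_higher :: "box \<Rightarrow> box \<Rightarrow> bool" where
  "strictly_higher (i, j) (i', j') \<longleftrightarrow> (i, j) \<noteq> (i', j') \<and> i \<le> i' \<and> j \<ge> j'"

definition listing :: "box set \<Rightarrow> box list \<Rightarrow> bool" where
  "listing Y xs \<longleftrightarrow> distinct xs \<and> set xs = Y"

definition reading :: "box list \<Rightarrow> tableau \<Rightarrow> letter list" where
  "reading xs T = map T xs"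

definition admissible :: "box list \<Rightarrow> bool" where
  "admissible xs \<longleftrightarrow>
     (\<forall>r < length xs. \<forall>s < length xs. strictly_higher (xs ! r) (xs ! s) \<longrightarrow> r < s)"

text \<open>The crystal structure on the tableaux of shape \<open>Y\<close> induced by the reading of a listing.\<close>

definition tableau_crystal :: "nat \<Rightarrow> nat \<Rightarrow> box set \<Rightarrow> box list \<Rightarrow> tableau crystal" where
  "tableau_crystal m n Y xs =
     induced_crystal (semistandard_tableaux m n Y) (reading xs) (tensor_power m n (card Y))"

end

theory Submission
  imports Defs
begin

text \<open>An operator of the tensor power changes one letter of a word. The theorem holds because, on the
  reading of a tableau, the box whose letter changes can be described by the tableau alone, and because
  that description leaves room in the row and the column of the box for the new entry.

  For an index other than \<open>0\<close> let \<open>a\<close> and \<open>b\<close> be the two letters involved, so that matched pairs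
  \<open>a \<dots> b\<close> cancel in a word and the operators act at the boundary between the remaining \<open>b\<close> and the
  remaining \<open>a\<close> (\<open>tensor_power_IBar\<close>, \<open>tensor_power_IPos\<close>). In a tableau some \<open>a\<close> and \<open>b\<close> occur together
  in a column (for \<open>Bar\<close> letters) or in a row (for \<open>Pos\<close> letters), and then \<open>a\<close> is read first. All other
  boxes with these letters are called free. Semistandardness and the convexity of skew diagrams force a
  free box to be comparable, in the relation ``strictly higher'', with every other box carrying \<open>a\<close> or
  \<open>b\<close> (\<open>free_comparable\<close>), and to have both members of a pair on the same side (\<open>mate_same_side\<close>).
  Consequently each admissible reading consists of the free boxes in one and the same order, with complete
  groups of cancelling pairs in between, although the order inside a group depends on the reading.
  Viewing the word as a walk with steps \<open>1\<close> and \<open>-1\<close>, the pairs only lift the walk and return it to its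
  level at each free box, so that the place where an operator acts is determined by the free boxes
  (\<open>active_iff_pivot\<close>). For \<open>Bar\<close> letters the box of this place has no partner in its column, and in its
  row no equal letter on the side where the new entry would not fit; for \<open>Pos\<close> letters rows and columns
  change roles (\<open>pivot_column\<close>, \<open>pivot_row_right\<close>, \<open>pivot_row_left\<close>). So the tableau stays semistandard.

  For the index \<open>0\<close> the first letter \<open>Bar 1\<close> or \<open>Pos 1\<close> of the word decides, and the box of this letter is
  strictly higher than all other boxes with such letters (\<open>summit_iff_first\<close>).

  The crystal axioms are verified once for the tensor power (\<open>is_crystal_tensor_power\<close>) and pass to stable
  subsets (\<open>is_crystal_induced\<close>).\<close>

section \<open>Iterates\<close>

lemma iter_0: "iter g 0 b = Some b"
  by (simp add: iter_def)

lemma iter_Suc: "iter g (Suc r) b = Option.bind (g b) (iter g r)"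
proof -
  have "((\<lambda>x. Option.bind x g) ^^ r) None = None"
    by (induction r) auto
  then show ?thesis
    unfolding iter_def funpow_Suc_right o_apply by (cases "g b") simp_all
qed

lemma iter_defined_imp_le:
  assumes "\<And>b b'. b \<in> S \<Longrightarrow> g b = Some b' \<Longrightarrow> b' \<in> S \<and> \<mu> b' < (\<mu> b :: nat)"
  shows "b \<in> S \<Longrightarrow> iter g r b \<noteq> None \<Longrightarrow> r \<le> \<mu> b"
proof (induction r arbitrary: b)
  case (Suc r)
  then obtain b' where b': "g b = Some b'" "iter g r b' \<noteq> None"
    by (cases "g b") (auto simp: iter_Suc)
  from assms[OF Suc.prems(1) b'(1)] have "b' \<in> S" "\<mu> b' < \<mu> b" by simp_all
  moreover from Suc.IH[OF this(1) b'(2)] have "r \<le> \<mu> b'" .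
  ultimately show ?case by linarith
qed simp

text \<open>A counter that drops by one at each step and vanishes exactly when no step is possible measures the
  length of the string; this turns the maxima in \<open>epsilon\<close> and \<open>phi\<close> into closed formulas.\<close>

lemma iter_defined_iff_le:
  assumes "\<And>b b'. b \<in> S \<Longrightarrow> g b = Some b' \<Longrightarrow> b' \<in> S \<and> \<mu> b = Suc (\<mu> b')"
    and "\<And>b. b \<in> S \<Longrightarrow> g b = None \<Longrightarrow> \<mu> b = 0"
  shows "b \<in> S \<Longrightarrow> iter g r b \<noteq> None \<longleftrightarrow> r \<le> \<mu> b"
proof (induction r arbitrary: b)
  case 0
  then show ?case by (simp add: iter_0)
next
  case (Suc r)
  show ?case
  proof (cases "g b")
    case None
    then show ?thesis using assms(2)[OF Suc.prems None] by (simp add: iter_Suc)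
  next
    case (Some b')
    from assms(1)[OF Suc.prems Some] have "b' \<in> S" "\<mu> b = Suc (\<mu> b')" by simp_all
    then show ?thesis using Suc.IH[OF \<open>b' \<in> S\<close>] Some by (simp add: iter_Suc)
  qed
qed

lemma Max_iter_defined:
  assumes "\<And>b b'. b \<in> S \<Longrightarrow> g b = Some b' \<Longrightarrow> b' \<in> S \<and> \<mu> b = Suc (\<mu> b')"
    and "\<And>b. b \<in> S \<Longrightarrow> g b = None \<Longrightarrow> \<mu> b = 0"
    and "b \<in> S"
  shows "finite {r. iter g r b \<noteq> None}" and "Max {r. iter g r b \<noteq> None} = \<mu> b"
proof -
  have eq: "{r. iter g r b \<noteq> None} = {..\<mu> b}"
    by (intro set_eqI) (simp only: mem_Collect_eq atMost_iff iter_defined_iff_le[of S g \<mu> b, OF assms])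
  show "finite {r. iter g r b \<noteq> None}"
    unfolding eq by simp
  show "Max {r. iter g r b \<noteq> None} = \<mu> b"
    unfolding eq by (rule Max_eqI) auto
qed

section \<open>The signature rule\<close>

text \<open>Bracketing: each letter \<open>a\<close> opens a bracket and each letter \<open>b\<close> closes one, and matched pairs
  cancel. What survives is a run of unmatched \<open>b\<close> followed by a run of unmatched \<open>a\<close>.\<close>

definition sign :: "'a \<Rightarrow> 'a \<Rightarrow> 'a \<Rightarrow> int" where
  "sign a b x = (if x = a then 1 else if x = b then - 1 else 0)"

text \<open>The number of unmatched \<open>b\<close> in a word, computed from the right by the recursion of the tensor
  product rule; \<open>excess\<close> below is the number of unmatched \<open>a\<close>.\<close>

primrec deficit :: "'a \<Rightarrow> 'a \<Rightarrow> 'a list \<Rightarrow> int" where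
  "deficit a b [] = 0"
| "deficit a b (x # w) = max 0 (deficit a b w - sign a b x)"

definition excess :: "'a \<Rightarrow> 'a \<Rightarrow> 'a list \<Rightarrow> int" where
  "excess a b w = deficit a b w + (\<Sum>x\<leftarrow>w. sign a b x)"

lemma deficit_nonneg: "0 \<le> deficit a b w"
  by (cases w) auto

lemma deficit_append:
  "deficit a b (u @ v) = max (deficit a b u) (deficit a b v - (\<Sum>x\<leftarrow>u. sign a b x))"
  using deficit_nonneg[of a b v] by (induction u) auto

lemma excess_Nil: "excess a b [] = 0"
  by (simp add: excess_def)

lemma excess_Cons:
  "excess a b (x # w) = max (excess a b w) (sign a b x + (\<Sum>y\<leftarrow>w. sign a b y))"
  by (auto simp: excess_def)

lemma excess_nonneg: "0 \<le> excess a b w"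
  by (induction w) (auto simp: excess_Cons excess_Nil)

lemma all_nat_iff: "(\<forall>q. P q) \<longleftrightarrow> P 0 \<and> (\<forall>q. P (Suc q))"
  by (auto simp: all_conj_distrib intro: nat.induct[of P])

text \<open>Brackets seen as a walk: the unmatched \<open>b\<close> measure how far the partial sums of the signs fall
  below \<open>0\<close>. The generalisation to an arbitrary bound \<open>t\<close> is what the induction needs.\<close>

lemma deficit_le_iff:
  "0 \<le> t \<Longrightarrow> deficit a b w \<le> t \<longleftrightarrow> (\<forall>q. - t \<le> (\<Sum>x\<leftarrow>take q w. sign a b x))"
proof (induction w arbitrary: t)
  case (Cons x w)
  have "deficit a b (x # w) \<le> t \<longleftrightarrow> deficit a b w \<le> t + sign a b x"
    using Cons.prems by auto
  also have "\<dots> \<longleftrightarrow> (\<forall>q. - t \<le> (\<Sum>y\<leftarrow>take (Suc q) (x # w). sign a b y))"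
  proof (cases "0 \<le> t + sign a b x")
    case True
    then show ?thesis by (subst Cons.IH) (auto simp: algebra_simps)
  next
    case False
    then have "\<not> deficit a b w \<le> t + sign a b x" using deficit_nonneg[of a b w] by linarith
    moreover have "\<not> - t \<le> (\<Sum>y\<leftarrow>take (Suc 0) (x # w). sign a b y)" using False by simp
    ultimately show ?thesis by blast
  qed
  also have "\<dots> \<longleftrightarrow> (\<forall>q. - t \<le> (\<Sum>y\<leftarrow>take q (x # w). sign a b y))"
    (is "_ \<longleftrightarrow> (\<forall>q. ?P q)")
  proof -
    have "?P 0" using Cons.prems by simp
    then show ?thesis using all_nat_iff[of ?P] by blast
  qed
  finally show ?case .
qed simp

lemma deficit_eq_0_iff: "deficit a b w = 0 \<longleftrightarrow> (\<forall>q. 0 \<le> (\<Sum>x\<leftarrow>take q w. sign a b x))"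
  using deficit_le_iff[of 0 a b w] deficit_nonneg[of a b w] by auto

lemma excess_eq_0_iff: "excess a b w = 0 \<longleftrightarrow> (\<forall>q. (\<Sum>x\<leftarrow>drop q w. sign a b x) \<le> 0)"
proof -
  have "excess a b w \<le> 0 \<longleftrightarrow> (\<forall>q. (\<Sum>x\<leftarrow>drop q w. sign a b x) \<le> 0)"
  proof (induction w)
    case (Cons x w)
    let ?P = "\<lambda>q. (\<Sum>y\<leftarrow>drop q (x # w). sign a b y) \<le> 0"
    have "excess a b (x # w) \<le> 0 \<longleftrightarrow> ?P 0 \<and> (\<forall>q. ?P (Suc q))"
      using Cons.IH by (auto simp: excess_Cons)
    also have "\<dots> \<longleftrightarrow> (\<forall>q. ?P q)" using all_nat_iff[of ?P] by blast
    finally show ?case .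
  qed (simp add: excess_Nil)
  with excess_nonneg[of a b w] show ?thesis by auto
qed

text \<open>One crystal move. The letter that changes is the leftmost unmatched \<open>a\<close> of \<open>w\<close> and, at the same
  time, the rightmost unmatched \<open>b\<close> of \<open>w'\<close>: nothing unmatched opens before it and nothing unmatched
  closes after it. Neither condition mentions the letter itself, so the raising and the lowering
  operator are this one relation read in two directions.\<close>

definition flip :: "'a \<Rightarrow> 'a \<Rightarrow> 'a list \<Rightarrow> 'a list \<Rightarrow> bool" where
  "flip a b w w' \<longleftrightarrow>
     (\<exists>u v. w = u @ a # v \<and> w' = u @ b # v \<and> excess a b u = 0 \<and> deficit a b v = 0)"

lemma flip_length: "flip a b w w' \<Longrightarrow> length w' = length w"
  by (auto simp: flip_def)

lemma flip_deficit:
  assumes "a \<noteq> b" and "flip a b w w'"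
  shows "deficit a b w' = deficit a b w + 1"
proof -
  obtain u v where w: "w = u @ a # v" "w' = u @ b # v"
    and 0: "excess a b u = 0" "deficit a b v = 0"
    using assms(2) by (auto simp: flip_def)
  have "(\<Sum>x\<leftarrow>u. sign a b x) = - deficit a b u" using 0(1) by (simp add: excess_def)
  then show ?thesis using assms(1) 0(2) deficit_nonneg[of a b u]
    by (simp add: w deficit_append sign_def)
qed

lemma flip_excess:
  assumes "a \<noteq> b" and "flip a b w w'"
  shows "excess a b w = excess a b w' + 1"
proof -
  have "(\<Sum>x\<leftarrow>w. sign a b x) = (\<Sum>x\<leftarrow>w'. sign a b x) + 2"
    using assms by (auto simp: flip_def sign_def)
  with flip_deficit[OF assms] show ?thesis by (simp add: excess_def)
qed

text \<open>The two recursions for \<open>flip\<close> reproduce the tensor product rule for a letter and a word: an \<open>a\<close> in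
  front is the leftmost unmatched one precisely when no unmatched \<open>b\<close> behind it closes it.\<close>

lemma flip_Cons_left:
  assumes "a \<noteq> b"
  shows "flip a b (x # w) y \<longleftrightarrow>
    (if x = a \<and> deficit a b w = 0 then y = b # w else (\<exists>w'. y = x # w' \<and> flip a b w w'))"
proof -
  (* if u has no unmatched a, then the unmatched b of w are those of u *)
  have rest: "excess a b (x # u) = 0 \<longleftrightarrow> excess a b u = 0 \<and> \<not> (x = a \<and> deficit a b w = 0)"
    if "w = u @ a # v" "deficit a b v = 0" for u v
  proof (cases "excess a b u = 0")
    case True
    then have s: "(\<Sum>x\<leftarrow>u. sign a b x) = - deficit a b u" by (simp add: excess_def)
    then have "deficit a b w = deficit a b u"
      using that deficit_nonneg[of a b u] by (simp add: deficit_append sign_def)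
    then show ?thesis using True s deficit_nonneg[of a b u]
      by (auto simp: excess_Cons sign_def)
  next
    case False
    then show ?thesis using excess_nonneg[of a b u] by (simp add: excess_Cons)
  qed
  have split: "flip a b (x # w) y \<longleftrightarrow> (x = a \<and> deficit a b w = 0 \<and> y = b # w) \<or>
     (\<exists>u v. w = u @ a # v \<and> y = x # u @ b # v \<and> excess a b (x # u) = 0 \<and> deficit a b v = 0)"
    (is "_ \<longleftrightarrow> ?head \<or> ?tail")
  proof
    assume "flip a b (x # w) y"
    then obtain u v where uv: "x # w = u @ a # v" "y = u @ b # v" "excess a b u = 0" "deficit a b v = 0"
      by (auto simp: flip_def)
    show "?head \<or> ?tail"
    proof (cases u)
      case Nil
      with uv show ?thesis by simp
    next
      case (Cons z u')
      with uv have "w = u' @ a # v" "y = x # u' @ b # v" "excess a b (x # u') = 0" by simp_all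
      with uv(4) show ?thesis by blast
    qed
  next
    assume "?head \<or> ?tail"
    then show "flip a b (x # w) y"
    proof
      assume ?head
      then have "x # w = [] @ a # w \<and> y = [] @ b # w \<and> excess a b [] = 0 \<and> deficit a b w = 0"
        by (simp add: excess_Nil)
      then show ?thesis unfolding flip_def by blast
    next
      assume ?tail
      then obtain u v where "w = u @ a # v" "y = x # u @ b # v" "excess a b (x # u) = 0" "deficit a b v = 0"
        by blast
      then have "x # w = (x # u) @ a # v \<and> y = (x # u) @ b # v \<and> excess a b (x # u) = 0 \<and> deficit a b v = 0"
        by simp
      then show ?thesis unfolding flip_def by blast
    qed
  qed
  show ?thesis
  proof (cases "x = a \<and> deficit a b w = 0")
    case True
    with rest have "\<nexists>u v. w = u @ a # v \<and> y = x # u @ b # v \<and> excess a b (x # u) = 0 \<and> deficit a b v = 0"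
      by blast
    then have "flip a b (x # w) y \<longleftrightarrow> x = a \<and> deficit a b w = 0 \<and> y = b # w"
      using split by blast
    with True show ?thesis by simp
  next
    case False
    have "flip a b (x # w) y \<longleftrightarrow> (\<exists>w'. y = x # w' \<and> flip a b w w')"
    proof -
      have "(\<exists>u v. w = u @ a # v \<and> y = x # u @ b # v \<and> excess a b (x # u) = 0 \<and> deficit a b v = 0)
        \<longleftrightarrow> (\<exists>u v. w = u @ a # v \<and> y = x # u @ b # v \<and> excess a b u = 0 \<and> deficit a b v = 0)"
        using rest False by blast
      also have "\<dots> \<longleftrightarrow> (\<exists>w'. y = x # w' \<and> flip a b w w')"
        unfolding flip_def by blast
      finally show ?thesis using split False by blast
    qed
    with False show ?thesis by (simp only: if_False)
  qed
qed

lemma flip_Cons_right: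
  assumes "a \<noteq> b"
  shows "flip a b y (x # w) \<longleftrightarrow>
    (if deficit a b w \<le> (if x = a then 1 else 0) then x = b \<and> y = a # w
     else (\<exists>w'. y = x # w' \<and> flip a b w' w))"
proof (cases y)
  case Nil
  then show ?thesis by (auto simp: flip_def)
next
  case (Cons z w')
  have flipped: "deficit a b w = deficit a b w' + 1" if "flip a b w' w"
    using flip_deficit[OF assms that] .
  show ?thesis
  proof (cases "z = a \<and> deficit a b w' = 0")
    case True
    then have "flip a b y (x # w) \<longleftrightarrow> x = b \<and> w = w'"
      unfolding Cons flip_Cons_left[OF assms] by auto
    then show ?thesis using True Cons assms flipped by auto
  next
    case False
    then have "flip a b y (x # w) \<longleftrightarrow> z = x \<and> flip a b w' w"
      unfolding Cons flip_Cons_left[OF assms] by auto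
    then show ?thesis
      using False Cons assms flipped deficit_nonneg[of a b w'] deficit_nonneg[of a b w] by auto
  qed
qed

text \<open>A move is possible whenever its counter is positive; with \<open>flip_deficit\<close> and \<open>flip_excess\<close> this
  makes \<open>deficit\<close> and \<open>excess\<close> the string lengths of the two operators.\<close>

lemma flip_right_exists:
  assumes "a \<noteq> b" and "deficit a b w > 0"
  shows "\<exists>y. flip a b y w"
  using assms(2)
proof (induction w)
  case (Cons x w)
  show ?case
  proof (cases "deficit a b w \<le> (if x = a then 1 else 0)")
    case True
    with Cons.prems have "x = b"
      using assms(1) by (auto simp: sign_def split: if_splits)
    with True assms(1) show ?thesis by (auto simp: flip_Cons_right[OF assms(1)])
  next
    case False
    then have "deficit a b w > 0" by (auto split: if_splits)
    with Cons.IH False show ?thesis by (auto simp: flip_Cons_right[OF assms(1)])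
  qed
qed simp

lemma flip_left_exists:
  assumes "a \<noteq> b" and "excess a b w > 0"
  shows "\<exists>y. flip a b w y"
  using assms(2)
proof (induction w)
  case (Cons x w)
  show ?case
  proof (cases "x = a \<and> deficit a b w = 0")
    case True
    then show ?thesis by (auto simp: flip_Cons_left[OF assms(1)])
  next
    case False
    have "excess a b w > 0"
      using Cons.prems False deficit_nonneg[of a b w] excess_nonneg[of a b w]
      by (auto simp: excess_def sign_def split: if_splits)
    with Cons.IH False show ?thesis by (auto simp: flip_Cons_left[OF assms(1)])
  qed
qed (simp add: excess_Nil)

lemma flip_left_iff_nth:
  "flip a b w w' \<longleftrightarrow> (\<exists>p<length w. w ! p = a \<and> w' = w[p := b] \<and>
     excess a b (take p w) = 0 \<and> deficit a b (drop (Suc p) w) = 0)"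
proof
  assume "flip a b w w'"
  then obtain u v where "w = u @ a # v" "w' = u @ b # v" "excess a b u = 0" "deficit a b v = 0"
    by (auto simp: flip_def)
  then show "\<exists>p<length w. w ! p = a \<and> w' = w[p := b] \<and>
      excess a b (take p w) = 0 \<and> deficit a b (drop (Suc p) w) = 0"
    by (intro exI[of _ "length u"]) (simp add: list_update_append)
next
  assume "\<exists>p<length w. w ! p = a \<and> w' = w[p := b] \<and>
      excess a b (take p w) = 0 \<and> deficit a b (drop (Suc p) w) = 0"
  then obtain p where p: "p < length w" "w ! p = a" "w' = w[p := b]"
    "excess a b (take p w) = 0" "deficit a b (drop (Suc p) w) = 0" by blast
  then show "flip a b w w'"
    unfolding flip_def using id_take_nth_drop[OF p(1)] upd_conv_take_nth_drop[OF p(1)]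
    by (intro exI[of _ "take p w"] exI[of _ "drop (Suc p) w"]) simp
qed

lemma flip_right_iff_nth:
  "flip a b w' w \<longleftrightarrow> (\<exists>p<length w. w ! p = b \<and> w' = w[p := a] \<and>
     excess a b (take p w) = 0 \<and> deficit a b (drop (Suc p) w) = 0)"
proof
  assume "flip a b w' w"
  then obtain u v where "w' = u @ a # v" "w = u @ b # v" "excess a b u = 0" "deficit a b v = 0"
    by (auto simp: flip_def)
  then show "\<exists>p<length w. w ! p = b \<and> w' = w[p := a] \<and>
      excess a b (take p w) = 0 \<and> deficit a b (drop (Suc p) w) = 0"
    by (intro exI[of _ "length u"]) (simp add: list_update_append)
next
  assume "\<exists>p<length w. w ! p = b \<and> w' = w[p := a] \<and>
      excess a b (take p w) = 0 \<and> deficit a b (drop (Suc p) w) = 0"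
  then obtain p where p: "p < length w" "w ! p = b" "w' = w[p := a]"
    "excess a b (take p w) = 0" "deficit a b (drop (Suc p) w) = 0" by blast
  then show "flip a b w' w"
    unfolding flip_def using id_take_nth_drop[OF p(1)] upd_conv_take_nth_drop[OF p(1)]
    by (intro exI[of _ "take p w"] exI[of _ "drop (Suc p) w"]) simp
qed

section \<open>Tensor powers of the vector representation\<close>

lemma iter_flip:
  assumes "a \<noteq> b" and g: "\<And>w y. length w = N \<Longrightarrow> g w = Some y \<longleftrightarrow> flip a b w y"
    and "length w = N"
  shows "finite {r. iter g r w \<noteq> None}" and "Max {r. iter g r w \<noteq> None} = nat (excess a b w)"
proof -
  let ?S = "{w. length w = N}"
  have 1: "y \<in> ?S \<and> nat (excess a b w) = Suc (nat (excess a b y))" if "w \<in> ?S" "g w = Some y" for w y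
  proof -
    have "flip a b w y" using that g by auto
    from flip_length[OF this] flip_excess[OF assms(1) this] show ?thesis
      using that(1) excess_nonneg[of a b y] by simp
  qed
  have 2: "nat (excess a b w) = 0" if "w \<in> ?S" "g w = None" for w
    using flip_left_exists[OF assms(1), of w] g[of w] that by fastforce
  have w: "w \<in> ?S" using assms(3) by simp
  note * = Max_iter_defined[of ?S g "\<lambda>w. nat (excess a b w)" w, OF 1 2 w]
  show "finite {r. iter g r w \<noteq> None}" by (rule *(1))
  show "Max {r. iter g r w \<noteq> None} = nat (excess a b w)" by (rule *(2))
qed

lemma iter_unflip:
  assumes "a \<noteq> b" and g: "\<And>w y. length w = N \<Longrightarrow> g w = Some y \<longleftrightarrow> flip a b y w"
    and "length w = N"
  shows "finite {r. iter g r w \<noteq> None}" and "Max {r. iter g r w \<noteq> None} = nat (deficit a b w)"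
proof -
  let ?S = "{w. length w = N}"
  have 1: "y \<in> ?S \<and> nat (deficit a b w) = Suc (nat (deficit a b y))" if "w \<in> ?S" "g w = Some y" for w y
  proof -
    have "flip a b y w" using that g by auto
    from flip_length[OF this] flip_deficit[OF assms(1) this] show ?thesis
      using that(1) deficit_nonneg[of a b y] by simp
  qed
  have 2: "nat (deficit a b w) = 0" if "w \<in> ?S" "g w = None" for w
    using flip_right_exists[OF assms(1), of w] g[of w] that by fastforce
  have w: "w \<in> ?S" using assms(3) by simp
  note * = Max_iter_defined[of ?S g "\<lambda>w. nat (deficit a b w)" w, OF 1 2 w]
  show "finite {r. iter g r w \<noteq> None}" by (rule *(1))
  show "Max {r. iter g r w \<noteq> None} = nat (deficit a b w)" by (rule *(2))
qed

lemma vector_crystal_simps [simp]: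
  "elts (vector_crystal m n) = letters m n"
  "wt (vector_crystal m n) = eps"
  "etil (vector_crystal m n) = vector_e m n"
  "ftil (vector_crystal m n) = vector_f m n"
  by (simp_all add: vector_crystal_def)

lemma phi_vector_crystal:
  "phi (vector_crystal m n) i x = (if vector_f m n i x = None then 0 else 1)"
  unfolding phi_def
proof (rule Max_iter_defined(2)[where S = UNIV])
  fix x y
  assume "ftil (vector_crystal m n) i x = Some y"
  then show "y \<in> UNIV \<and> (if vector_f m n i x = None then 0 else 1) =
      Suc (if vector_f m n i y = None then 0 else 1)"
    by (cases i) (auto simp: vector_crystal_def split: if_splits)
qed (auto simp: vector_crystal_def)

lemma epsilon_vector_crystal:
  "epsilon (vector_crystal m n) i x = (if vector_e m n i x = None then 0 else 1)"
  unfolding epsilon_def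
proof (rule Max_iter_defined(2)[where S = UNIV])
  fix x y
  assume "etil (vector_crystal m n) i x = Some y"
  then show "y \<in> UNIV \<and> (if vector_e m n i x = None then 0 else 1) =
      Suc (if vector_e m n i y = None then 0 else 1)"
    by (cases i) (auto simp: vector_crystal_def split: if_splits)
qed (auto simp: vector_crystal_def)

lemma etil_tensor_power_Cons:
  "etil (tensor_power m n (Suc N)) i (x # w) =
     map_option (\<lambda>(b, v). b # v) (tensor_e (vector_crystal m n) (tensor_power m n N) i (x, w))"
  by (simp add: Let_def tensor_def)

lemma ftil_tensor_power_Cons:
  "ftil (tensor_power m n (Suc N)) i (x # w) =
     map_option (\<lambda>(b, v). b # v) (tensor_f (vector_crystal m n) (tensor_power m n N) i (x, w))"
  by (simp add: Let_def tensor_def)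

lemma flip_Nil: "\<not> flip a b [] y" "\<not> flip a b y []"
  by (simp_all add: flip_def)

text \<open>The identification of the operators has to be proved in one induction with their string lengths,
  because the tensor product rule at length \<open>Suc N\<close> compares string lengths at length \<open>N\<close>.\<close>

lemma tensor_power_IBar:
  assumes k: "1 \<le> k" "k < m"
  shows "length w = N \<Longrightarrow>
    (ftil (tensor_power m n N) (IBar k) w = Some y \<longleftrightarrow> flip (Bar (Suc k)) (Bar k) w y) \<and>
    (etil (tensor_power m n N) (IBar k) w = Some y \<longleftrightarrow> flip (Bar (Suc k)) (Bar k) y w)"
proof (induction N arbitrary: w y)
  case 0
  then show ?case by (simp add: flip_Nil)
next
  case (Suc N)
  let ?a = "Bar (Suc k)" and ?b = "Bar k" and ?D = "tensor_power m n N"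
  have ab: "?a \<noteq> ?b" by simp
  obtain x w' where w: "w = x # w'" "length w' = N" using Suc.prems by (cases w) auto
  have eps: "epsilon ?D (IBar k) w' = nat (deficit ?a ?b w')"
    unfolding epsilon_def by (rule iter_unflip(2)[OF ab _ w(2)]) (use Suc.IH in blast)
  have f: "ftil ?D (IBar k) w' = Some v \<longleftrightarrow> flip ?a ?b w' v"
    and e: "etil ?D (IBar k) w' = Some v \<longleftrightarrow> flip ?a ?b v w'" for v
    using Suc.IH[OF w(2)] by blast+
  have "ftil (tensor_power m n (Suc N)) (IBar k) w = Some y \<longleftrightarrow> flip ?a ?b w y"
    unfolding w(1) ftil_tensor_power_Cons flip_Cons_left[OF ab] using k deficit_nonneg[of ?a ?b w']
    by (auto simp: phi_vector_crystal eps on_fst_def on_snd_def f split: if_splits)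
  moreover have "etil (tensor_power m n (Suc N)) (IBar k) w = Some y \<longleftrightarrow> flip ?a ?b y w"
    unfolding w(1) etil_tensor_power_Cons flip_Cons_right[OF ab] using k deficit_nonneg[of ?a ?b w']
    by (auto simp: phi_vector_crystal eps on_fst_def on_snd_def e split: if_splits)
  ultimately show ?case ..
qed

text \<open>The rule for the indices of the second kind is the opposite tensor product. Reversing the
  order of the factors has the same effect as exchanging \<open>etil\<close> with \<open>ftil\<close> and \<open>a\<close> with \<open>b\<close>, so the relation is again \<open>flip\<close>, with
  \<open>a = Pos (Suc k)\<close>, \<open>b = Pos k\<close>, and with \<open>etil\<close> as the forward direction.\<close>

lemma tensor_power_IPos:
  assumes k: "1 \<le> k" "k < n"
  shows "length w = N \<Longrightarrow>
    (etil (tensor_power m n N) (IPos k) w = Some y \<longleftrightarrow> flip (Pos (Suc k)) (Pos k) w y) \<and>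
    (ftil (tensor_power m n N) (IPos k) w = Some y \<longleftrightarrow> flip (Pos (Suc k)) (Pos k) y w)"
proof (induction N arbitrary: w y)
  case 0
  then show ?case by (simp add: flip_Nil)
next
  case (Suc N)
  let ?a = "Pos (Suc k)" and ?b = "Pos k" and ?D = "tensor_power m n N"
  have ab: "?a \<noteq> ?b" by simp
  obtain x w' where w: "w = x # w'" "length w' = N" using Suc.prems by (cases w) auto
  have phi: "phi ?D (IPos k) w' = nat (deficit ?a ?b w')"
    unfolding phi_def by (rule iter_unflip(2)[OF ab _ w(2)]) (use Suc.IH in blast)
  have e: "etil ?D (IPos k) w' = Some v \<longleftrightarrow> flip ?a ?b w' v"
    and f: "ftil ?D (IPos k) w' = Some v \<longleftrightarrow> flip ?a ?b v w'" for v
    using Suc.IH[OF w(2)] by blast+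
  have "etil (tensor_power m n (Suc N)) (IPos k) w = Some y \<longleftrightarrow> flip ?a ?b w y"
    unfolding w(1) etil_tensor_power_Cons flip_Cons_left[OF ab] using k deficit_nonneg[of ?a ?b w']
    by (auto simp: epsilon_vector_crystal phi on_fst_def on_snd_def e split: if_splits)
  moreover have "ftil (tensor_power m n (Suc N)) (IPos k) w = Some y \<longleftrightarrow> flip ?a ?b y w"
    unfolding w(1) ftil_tensor_power_Cons flip_Cons_right[OF ab] using k deficit_nonneg[of ?a ?b w']
    by (auto simp: epsilon_vector_crystal phi on_fst_def on_snd_def f split: if_splits)
  ultimately show ?case ..
qed

text \<open>At the index \<open>0\<close> there is no cancellation: only letters \<open>Bar 1\<close> and \<open>Pos 1\<close> have nonzero pairing with
  the coroot, so the first of them in the word decides.\<close>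

definition flip_first :: "letter list \<Rightarrow> letter list \<Rightarrow> bool" where
  "flip_first w w' \<longleftrightarrow>
     (\<exists>u v. w = u @ Bar 1 # v \<and> w' = u @ Pos 1 # v \<and> Bar 1 \<notin> set u \<and> Pos 1 \<notin> set u)"

lemma flip_first_Cons_left:
  "flip_first (x # w) y \<longleftrightarrow>
    (if x \<in> {Bar 1, Pos 1} then x = Bar 1 \<and> y = Pos 1 # w else (\<exists>w'. y = x # w' \<and> flip_first w w'))"
proof
  assume "flip_first (x # w) y"
  then obtain u v where uv: "x # w = u @ Bar 1 # v" "y = u @ Pos 1 # v" "Bar 1 \<notin> set u" "Pos 1 \<notin> set u"
    by (auto simp: flip_first_def)
  then show "if x \<in> {Bar 1, Pos 1} then x = Bar 1 \<and> y = Pos 1 # w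
      else (\<exists>w'. y = x # w' \<and> flip_first w w')"
    by (cases u) (auto simp: flip_first_def)
next
  assume r: "if x \<in> {Bar 1, Pos 1} then x = Bar 1 \<and> y = Pos 1 # w
      else (\<exists>w'. y = x # w' \<and> flip_first w w')"
  show "flip_first (x # w) y"
  proof (cases "x \<in> {Bar 1, Pos 1}")
    case True
    with r have "x # w = [] @ Bar 1 # w \<and> y = [] @ Pos 1 # w \<and> Bar 1 \<notin> set [] \<and> Pos 1 \<notin> set []"
      by auto
    then show ?thesis unfolding flip_first_def by blast
  next
    case False
    with r obtain u v where "w = u @ Bar 1 # v" "y = x # u @ Pos 1 # v" "Bar 1 \<notin> set u" "Pos 1 \<notin> set u"
      by (auto simp: flip_first_def)
    with False have "x # w = (x # u) @ Bar 1 # v \<and> y = (x # u) @ Pos 1 # v \<and>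
        Bar 1 \<notin> set (x # u) \<and> Pos 1 \<notin> set (x # u)"
      by auto
    then show ?thesis unfolding flip_first_def by blast
  qed
qed

lemma flip_first_Cons_right:
  "flip_first y (x # w) \<longleftrightarrow>
    (if x \<in> {Bar 1, Pos 1} then x = Pos 1 \<and> y = Bar 1 # w else (\<exists>w'. y = x # w' \<and> flip_first w' w))"
proof (cases y)
  case Nil
  then show ?thesis by (auto simp: flip_first_def)
next
  case (Cons z w')
  then show ?thesis by (auto simp: flip_first_Cons_left)
qed

lemma flip_first_left_iff_nth:
  "flip_first w w' \<longleftrightarrow> (\<exists>p<length w. w ! p = Bar 1 \<and> w' = w[p := Pos 1] \<and>
     set (take p w) \<inter> {Bar 1, Pos 1} = {})"
proof
  assume "flip_first w w'"
  then obtain u v where "w = u @ Bar 1 # v" "w' = u @ Pos 1 # v" "Bar 1 \<notin> set u" "Pos 1 \<notin> set u"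
    by (auto simp: flip_first_def)
  then show "\<exists>p<length w. w ! p = Bar 1 \<and> w' = w[p := Pos 1] \<and> set (take p w) \<inter> {Bar 1, Pos 1} = {}"
    by (intro exI[of _ "length u"]) (simp add: list_update_append)
next
  assume "\<exists>p<length w. w ! p = Bar 1 \<and> w' = w[p := Pos 1] \<and> set (take p w) \<inter> {Bar 1, Pos 1} = {}"
  then obtain p where p: "p < length w" "w ! p = Bar 1" "w' = w[p := Pos 1]"
    "set (take p w) \<inter> {Bar 1, Pos 1} = {}" by blast
  then show "flip_first w w'"
    unfolding flip_first_def using id_take_nth_drop[OF p(1)] upd_conv_take_nth_drop[OF p(1)]
    by (intro exI[of _ "take p w"] exI[of _ "drop (Suc p) w"]) simp
qed

lemma flip_first_right_iff_nth:
  "flip_first w' w \<longleftrightarrow> (\<exists>p<length w. w ! p = Pos 1 \<and> w' = w[p := Bar 1] \<and>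
     set (take p w) \<inter> {Bar 1, Pos 1} = {})"
proof
  assume "flip_first w' w"
  then obtain u v where "w' = u @ Bar 1 # v" "w = u @ Pos 1 # v" "Bar 1 \<notin> set u" "Pos 1 \<notin> set u"
    by (auto simp: flip_first_def)
  then show "\<exists>p<length w. w ! p = Pos 1 \<and> w' = w[p := Bar 1] \<and> set (take p w) \<inter> {Bar 1, Pos 1} = {}"
    by (intro exI[of _ "length u"]) (simp add: list_update_append)
next
  assume "\<exists>p<length w. w ! p = Pos 1 \<and> w' = w[p := Bar 1] \<and> set (take p w) \<inter> {Bar 1, Pos 1} = {}"
  then obtain p where p: "p < length w" "w ! p = Pos 1" "w' = w[p := Bar 1]"
    "set (take p w) \<inter> {Bar 1, Pos 1} = {}" by blast
  then show "flip_first w' w"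
    unfolding flip_first_def using id_take_nth_drop[OF p(1)] upd_conv_take_nth_drop[OF p(1)]
    by (intro exI[of _ "take p w"] exI[of _ "drop (Suc p) w"]) simp
qed

lemma tensor_power_IZero:
  "length w = N \<Longrightarrow>
    (ftil (tensor_power m n N) IZero w = Some y \<longleftrightarrow> flip_first w y) \<and>
    (etil (tensor_power m n N) IZero w = Some y \<longleftrightarrow> flip_first y w)"
proof (induction N arbitrary: w y)
  case 0
  then show ?case by (simp add: flip_first_def)
next
  case (Suc N)
  let ?D = "tensor_power m n N"
  obtain x w' where w: "w = x # w'" "length w' = N" using Suc.prems by (cases w) auto
  have f: "ftil ?D IZero w' = Some v \<longleftrightarrow> flip_first w' v"
    and e: "etil ?D IZero w' = Some v \<longleftrightarrow> flip_first v w'" for v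
    using Suc.IH[OF w(2)] by blast+
  have p: "pairing IZero (wt (vector_crystal m n) x) > 0 \<longleftrightarrow> x \<in> {Bar 1, Pos 1}"
    by (auto simp: eps_def)
  have "ftil (tensor_power m n (Suc N)) IZero w = Some y \<longleftrightarrow> flip_first w y"
    unfolding w(1) ftil_tensor_power_Cons flip_first_Cons_left tensor_f.simps p
    by (auto simp: on_fst_def on_snd_def f)
  moreover have "etil (tensor_power m n (Suc N)) IZero w = Some y \<longleftrightarrow> flip_first y w"
    unfolding w(1) etil_tensor_power_Cons flip_first_Cons_right tensor_e.simps p
    by (auto simp: on_fst_def on_snd_def e)
  ultimately show ?case ..
qed

lemma elts_tensor_power:
  "elts (tensor_power m n N) = {w. set w \<subseteq> letters m n \<and> length w = N}"
proof (induction N)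
  case (Suc N)
  have "elts (tensor_power m n (Suc N)) = (\<lambda>(b, w). b # w) ` (letters m n \<times> elts (tensor_power m n N))"
    by (simp add: Let_def tensor_def)
  also have "\<dots> = {w. set w \<subseteq> letters m n \<and> length w = Suc N}"
    unfolding Suc.IH by (auto simp: image_iff length_Suc_conv)
  finally show ?case .
qed auto

lemma wt_tensor_power:
  "length w = N \<Longrightarrow> wt (tensor_power m n N) w = (\<lambda>c. int (count_list w c))"
proof (induction N arbitrary: w)
  case (Suc N)
  then obtain x w' where "w = x # w'" "length w' = N" by (cases w) auto
  with Suc.IH show ?case
    by (auto simp: Let_def tensor_def eps_def fun_eq_iff)
qed auto

lemma sum_sign: "a \<noteq> b \<Longrightarrow> (\<Sum>x\<leftarrow>w. sign a b x) = int (count_list w a) - int (count_list w b)"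
  by (induction w) (auto simp: sign_def)

lemma excess_minus_deficit:
  "a \<noteq> b \<Longrightarrow> excess a b w - deficit a b w = int (count_list w a) - int (count_list w b)"
  by (simp add: excess_def sum_sign)

text \<open>Each step removes one letter \<open>a\<close>. This is used for the index \<open>0\<close> as well, where \<open>phi\<close> and \<open>epsilon\<close> are
  not tied to the weight.\<close>

lemma iter_replace_finite:
  assumes "\<And>w y. length w = N \<Longrightarrow> g w = Some y \<Longrightarrow> \<exists>u v. w = u @ a # v \<and> y = u @ b # v"
    and "length w = N" and "a \<noteq> b"
  shows "finite {r. iter g r w \<noteq> None}"
proof (rule finite_subset)
  have step: "y \<in> {w. length w = N} \<and> count_list y a < count_list w a"
    if w: "w \<in> {w. length w = N}" and g: "g w = Some y" for w y
  proof -
    from assms(1)[OF _ g] w obtain u v where "w = u @ a # v" "y = u @ b # v" by auto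
    with w assms(3) show ?thesis by simp
  qed
  have "r \<le> count_list w a" if "iter g r w \<noteq> None" for r
    by (rule iter_defined_imp_le[where S = "{w. length w = N}" and g = g, OF step _ that])
      (use assms(2) in auto)
  then show "{r. iter g r w \<noteq> None} \<subseteq> {..count_list w a}" by (simp only: subset_iff mem_Collect_eq atMost_iff) blast
qed simp

text \<open>What the crystal axioms need from an operator, uniformly in the index: it replaces one letter by
  another whose weight differs by the simple root, and it is inverted by its partner.\<close>

lemma tensor_power_moves:
  assumes "1 \<le> m" "1 \<le> n" and "i \<in> indices m n"
  obtains a b where "a \<in> letters m n" "b \<in> letters m n" "a \<noteq> b" "root i = (\<lambda>c. eps a c - eps b c)"
    "\<And>w y. length w = N \<Longrightarrow> ftil (tensor_power m n N) i w = Some y \<Longrightarrow>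
       \<exists>u v. w = u @ a # v \<and> y = u @ b # v"
    "\<And>w y. length w = N \<Longrightarrow> length y = N \<Longrightarrow>
       ftil (tensor_power m n N) i w = Some y \<longleftrightarrow> etil (tensor_power m n N) i y = Some w"
    "\<And>w y. length w = N \<Longrightarrow> etil (tensor_power m n N) i w = Some y \<Longrightarrow>
       \<exists>u v. w = u @ b # v \<and> y = u @ a # v"
proof (cases i)
  case (IBar k)
  with assms have k: "1 \<le> k" "k < m" by (auto simp: indices_def)
  have "Bar (Suc k) \<in> letters m n" "Bar k \<in> letters m n" using k by (auto simp: letters_def letters_plus_def)
  then show ?thesis
    by (rule that) (use k in \<open>auto simp: IBar tensor_power_IBar flip_def\<close>)
next
  case IZero
  have "Bar 1 \<in> letters m n" "Pos 1 \<in> letters m n"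
    using assms by (auto simp: letters_def letters_plus_def letters_minus_def)
  then show ?thesis
    by (rule that) (auto simp: IZero tensor_power_IZero flip_first_def)
next
  case (IPos k)
  with assms have k: "1 \<le> k" "k < n" by (auto simp: indices_def)
  have "Pos k \<in> letters m n" "Pos (Suc k) \<in> letters m n" using k by (auto simp: letters_def letters_minus_def)
  then show ?thesis
    by (rule that) (use k in \<open>auto simp: IPos tensor_power_IPos flip_def\<close>)
qed

lemma tensor_power_phi_minus_epsilon:
  assumes "i \<in> indices m n" "i \<noteq> IZero" and w: "length w = N"
  shows "int (phi (tensor_power m n N) i w) - int (epsilon (tensor_power m n N) i w) =
    pairing i (wt (tensor_power m n N) w)"
proof (cases i)
  case (IBar k)
  let ?a = "Bar (Suc k)" and ?b = "Bar k"
  from IBar assms(1) have k: "1 \<le> k" "k < m" by (auto simp: indices_def)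
  have "phi (tensor_power m n N) i w = nat (excess ?a ?b w)"
    unfolding phi_def IBar by (rule iter_flip(2)[OF _ _ w]) (simp, use tensor_power_IBar[OF k] in blast)
  moreover have "epsilon (tensor_power m n N) i w = nat (deficit ?a ?b w)"
    unfolding epsilon_def IBar by (rule iter_unflip(2)[OF _ _ w]) (simp, use tensor_power_IBar[OF k] in blast)
  ultimately show ?thesis using w using excess_minus_deficit[of ?a ?b w]
    by (simp add: IBar wt_tensor_power excess_nonneg deficit_nonneg)
next
  case (IPos k)
  let ?a = "Pos (Suc k)" and ?b = "Pos k"
  from IPos assms(1) have k: "1 \<le> k" "k < n" by (auto simp: indices_def)
  have "epsilon (tensor_power m n N) i w = nat (excess ?a ?b w)"
    unfolding epsilon_def IPos by (rule iter_flip(2)[OF _ _ w]) (simp, use tensor_power_IPos[OF k] in blast)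
  moreover have "phi (tensor_power m n N) i w = nat (deficit ?a ?b w)"
    unfolding phi_def IPos by (rule iter_unflip(2)[OF _ _ w]) (simp, use tensor_power_IPos[OF k] in blast)
  ultimately show ?thesis using w excess_minus_deficit[of ?a ?b w]
    by (simp add: IPos wt_tensor_power excess_nonneg deficit_nonneg)
qed (use assms in simp)

theorem is_crystal_tensor_power:
  assumes "1 \<le> m" and "1 \<le> n"
  shows "is_crystal m n (tensor_power m n N)"
  unfolding is_crystal_def
proof (intro conjI ballI)
  let ?C = "tensor_power m n N"
  fix w assume w: "w \<in> elts ?C"
  then have len: "length w = N" by (simp add: elts_tensor_power)
  have "count_list w c = 0" if "c \<notin> letters m n" for c
    using that w by (auto simp: elts_tensor_power count_list_0_iff)
  then show "wt ?C w \<in> weight_lattice m n" by (simp add: wt_tensor_power len weight_lattice_def)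
  show "0 \<le> pairing IZero (wt ?C w)" by (simp add: wt_tensor_power len)
  fix i assume i: "i \<in> indices m n"
  obtain a b where ab: "a \<in> letters m n" "b \<in> letters m n" "a \<noteq> b" "root i = (\<lambda>c. eps a c - eps b c)"
    and f: "\<And>w y. length w = N \<Longrightarrow> ftil ?C i w = Some y \<Longrightarrow> \<exists>u v. w = u @ a # v \<and> y = u @ b # v"
    and fe: "\<And>w y. length w = N \<Longrightarrow> length y = N \<Longrightarrow> ftil ?C i w = Some y \<longleftrightarrow> etil ?C i y = Some w"
    and e: "\<And>w y. length w = N \<Longrightarrow> etil ?C i w = Some y \<Longrightarrow> \<exists>u v. w = u @ b # v \<and> y = u @ a # v"
    using tensor_power_moves[OF assms i, where N = N] by blast
  show "set_option (etil ?C i w) \<subseteq> elts ?C"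
  proof
    fix y assume "y \<in> set_option (etil ?C i w)"
    then obtain u v where "w = u @ b # v" "y = u @ a # v" using e[OF len] by auto
    with w ab show "y \<in> elts ?C" by (simp add: elts_tensor_power)
  qed
  show "set_option (ftil ?C i w) \<subseteq> elts ?C"
  proof
    fix y assume "y \<in> set_option (ftil ?C i w)"
    then obtain u v where "w = u @ a # v" "y = u @ b # v" using f[OF len] by auto
    with w ab show "y \<in> elts ?C" by (simp add: elts_tensor_power)
  qed
  show "finite {r. iter (etil ?C i) r w \<noteq> None}"
    by (rule iter_replace_finite[of N _ b a]) (use e len ab(3) in blast)+
  show "finite {r. iter (ftil ?C i) r w \<noteq> None}"
    by (rule iter_replace_finite[of N _ a b]) (use f len ab(3) in blast)+
  show "i \<noteq> IZero \<longrightarrow> int (phi ?C i w) - int (epsilon ?C i w) = pairing i (wt ?C w)"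
    using tensor_power_phi_minus_epsilon[OF i _ len] by blast
  fix y assume y: "y \<in> elts ?C"
  then have leny: "length y = N" by (simp add: elts_tensor_power)
  show "ftil ?C i w = Some y \<longleftrightarrow> etil ?C i y = Some w"
    by (rule fe[OF len leny])
  show "ftil ?C i w = Some y \<longrightarrow> wt ?C y = (\<lambda>c. wt ?C w c - root i c)"
  proof
    assume "ftil ?C i w = Some y"
    from f[OF len this] obtain u v where "w = u @ a # v" "y = u @ b # v" by blast
    then show "wt ?C y = (\<lambda>c. wt ?C w c - root i c)"
      using ab len leny by (simp only: wt_tensor_power) (auto simp: eps_def fun_eq_iff)
  qed
qed

section \<open>Fillings by levels\<close>

text \<open>The geometry behind the indices other than \<open>0\<close>. Only two letters matter for such an index; \<open>level\<close>
  comes from a monotone numbering of the letters that gives these two the values \<open>0\<close> and \<open>1\<close>.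
  The coordinates are integers so that one locale serves both kinds of index: for the second kind the diagram is reflected in its antidiagonal, which swaps rows and columns but keeps the
  relation ``strictly higher'', and the order of the letters is reversed. In both cases level \<open>0\<close>
  carries the letter \<open>a\<close> and level \<open>1\<close> the letter \<open>b\<close>.\<close>

locale level_filling =
  fixes Y :: "'x set" and row col level :: "'x \<Rightarrow> int"
  assumes finite_boxes: "finite Y"
    and box_eq: "x \<in> Y \<Longrightarrow> y \<in> Y \<Longrightarrow> row x = row y \<Longrightarrow> col x = col y \<Longrightarrow> x = y"
    and corner_SW: "x \<in> Y \<Longrightarrow> y \<in> Y \<Longrightarrow> row x \<le> row y \<Longrightarrow> col x \<le> col y \<Longrightarrow>
      \<exists>z\<in>Y. row z = row y \<and> col z = col x"
    and corner_NE: "x \<in> Y \<Longrightarrow> y \<in> Y \<Longrightarrow> row x \<le> row y \<Longrightarrow> col x \<le> col y \<Longrightarrow>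
      \<exists>z\<in>Y. row z = row x \<and> col z = col y"
    and level_row: "x \<in> Y \<Longrightarrow> y \<in> Y \<Longrightarrow> row x = row y \<Longrightarrow> col x < col y \<Longrightarrow> level x \<le> level y"
    and level_col: "x \<in> Y \<Longrightarrow> y \<in> Y \<Longrightarrow> col x = col y \<Longrightarrow> row x < row y \<Longrightarrow>
      level x < level y \<or> level x = level y \<and> level x \<notin> {0, 1}"
begin

definition higher :: "'x \<Rightarrow> 'x \<Rightarrow> bool" where
  "higher x y \<longleftrightarrow> x \<noteq> y \<and> row x \<le> row y \<and> col y \<le> col x"

definition live :: "'x \<Rightarrow> bool" where
  "live x \<longleftrightarrow> x \<in> Y \<and> level x \<in> {0, 1}"

definition charge :: "'x \<Rightarrow> int" where
  "charge x = (if level x = 0 then 1 else if level x = 1 then - 1 else 0)"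

text \<open>A column contains at most one box of each of the two levels. Two live boxes in a column form a
  bracket pair that cancels in every admissible reading.\<close>

definition partner :: "'x \<Rightarrow> 'x \<Rightarrow> bool" where
  "partner x y \<longleftrightarrow> live x \<and> live y \<and> x \<noteq> y \<and> col x = col y"

definition free :: "'x \<Rightarrow> bool" where
  "free x \<longleftrightarrow> live x \<and> (\<nexists>y. partner x y)"

definition paired :: "'x \<Rightarrow> bool" where
  "paired x \<longleftrightarrow> (\<exists>y. partner x y)"

definition mate :: "'x \<Rightarrow> 'x" where
  "mate x = (THE y. partner x y)"

lemma level_col_le: "x \<in> Y \<Longrightarrow> y \<in> Y \<Longrightarrow> col x = col y \<Longrightarrow> row x \<le> row y \<Longrightarrow> level x \<le> level y"
  using level_col[of x y] box_eq[of x y] by force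

lemma level_row_le: "x \<in> Y \<Longrightarrow> y \<in> Y \<Longrightarrow> row x = row y \<Longrightarrow> col x \<le> col y \<Longrightarrow> level x \<le> level y"
  using level_row[of x y] box_eq[of x y] by force

lemma live_or_uncharged: "live x \<or> charge x = 0" if "x \<in> Y"
  using that by (auto simp: live_def charge_def)

lemma partner_sym: "partner x y \<Longrightarrow> partner y x"
  by (auto simp: partner_def)

lemma partner_levels:
  assumes "partner x y"
  shows "level x = 0 \<and> level y = 1 \<and> row x < row y \<or> level x = 1 \<and> level y = 0 \<and> row y < row x"
proof -
  have xy: "x \<in> Y" "y \<in> Y" "col x = col y" "level x \<in> {0, 1}" "level y \<in> {0, 1}" "x \<noteq> y"
    using assms by (auto simp: partner_def live_def)
  then have "row x \<noteq> row y" using box_eq by blast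
  then consider "row x < row y" | "row y < row x" by linarith
  then show ?thesis
  proof cases
    case 1
    with level_col[OF xy(1,2,3)] xy(4,5) show ?thesis by auto
  next
    case 2
    with level_col[OF xy(2,1) xy(3)[symmetric]] xy(4,5) show ?thesis by auto
  qed
qed

lemma partner_unique: "partner x y \<Longrightarrow> partner x z \<Longrightarrow> y = z"
proof (rule ccontr)
  assume xy: "partner x y" and xz: "partner x z" and "y \<noteq> z"
  then have "partner y z" by (auto simp: partner_def)
  then show False using partner_levels[OF xy] partner_levels[OF xz] partner_levels[of y z] by auto
qed

lemma partner_mate: "paired x \<Longrightarrow> partner x (mate x)"
  unfolding paired_def mate_def by (metis theI partner_unique)

lemma mate_eqI: "partner x y \<Longrightarrow> mate x = y"
  using partner_mate partner_unique paired_def by blast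

lemma paired_mate: "paired x \<Longrightarrow> paired (mate x)"
  using partner_mate partner_sym paired_def by blast

lemma mate_mate: "paired x \<Longrightarrow> mate (mate x) = x"
  using partner_mate partner_sym mate_eqI by blast

lemma charge_mate: "paired x \<Longrightarrow> charge (mate x) = - charge x"
  using partner_levels[OF partner_mate[of x]] by (auto simp: charge_def)

lemma live_iff: "live x \<longleftrightarrow> free x \<or> paired x"
  by (auto simp: free_def paired_def partner_def)

lemma free_not_paired: "free x \<Longrightarrow> \<not> paired x"
  by (auto simp: free_def paired_def)

text \<open>If a live box lay strictly south-east or north-west of \<open>x\<close>, then the corner of the rectangle in the
  column of \<open>x\<close> would have a level squeezed between \<open>0\<close> and \<open>1\<close>, and would be a partner of \<open>x\<close>. Hence
  all admissible listings agree on the position of a free box relative to every live box.\<close>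

lemma free_comparable:
  assumes x: "free x" and y: "live y" "x \<noteq> y"
  shows "higher x y \<or> higher y x"
proof -
  have Y: "x \<in> Y" "y \<in> Y" and lx: "level x \<in> {0, 1}" and ly: "level y \<in> {0, 1}"
    using x y by (auto simp: free_def live_def)
  have alone: "z = x" if "z \<in> Y" "col z = col x" "level z \<in> {0, 1}" for z
    using x that by (auto simp: free_def partner_def live_def)
  consider "row x < row y" "col x < col y" | "row y < row x" "col y < col x" | "higher x y \<or> higher y x"
    using y(2) by (auto simp: higher_def) linarith
  then show ?thesis
  proof cases
    case 1
    then obtain z where z: "z \<in> Y" "row z = row y" "col z = col x"
      using corner_SW[of x y] Y by auto
    have "level x \<le> level z" "level z \<le> level y"
      using level_col_le[of x z] level_row_le[of z y] z Y 1 by auto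
    then have "0 \<le> level z" "level z \<le> 1" using lx ly by auto
    then have "level z = 0 \<or> level z = 1" by presburger
    then have "z = x" using alone z by auto
    with z 1 show ?thesis by simp
  next
    case 2
    then obtain z where z: "z \<in> Y" "row z = row y" "col z = col x"
      using corner_NE[of y x] Y by auto
    have "level y \<le> level z" "level z \<le> level x"
      using level_col_le[of z x] level_row_le[of y z] z Y 2 by auto
    then have "0 \<le> level z" "level z \<le> 1" using lx ly by auto
    then have "level z = 0 \<or> level z = 1" by presburger
    then have "z = x" using alone z by auto
    with z 2 show ?thesis by simp
  qed
qed

lemma higher_trans: "higher x y \<Longrightarrow> higher y z \<Longrightarrow> x \<in> Y \<Longrightarrow> y \<in> Y \<Longrightarrow> higher x z"
  using box_eq[of x y] by (auto simp: higher_def)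

text \<open>Free boxes never separate a pair: \<open>x\<close> is comparable with both members, they share a column different
  from that of \<open>x\<close>, and the order of the two columns decides both comparisons.\<close>

lemma mate_same_side:
  assumes x: "free x" and y: "paired y"
  shows "higher x y \<Longrightarrow> higher x (mate y)" and "higher y x \<Longrightarrow> higher (mate y) x"
proof -
  have p: "partner y (mate y)" by (rule partner_mate[OF y])
  have ne: "col x \<noteq> col y"
    using x y p free_not_paired[OF x] by (auto simp: free_def partner_def)
  have m: "x \<noteq> mate y" "live (mate y)" "col (mate y) = col y"
    using ne p by (auto simp: partner_def)
  have cmp: "higher x (mate y) \<or> higher (mate y) x"
    by (rule free_comparable[OF x m(2,1)])
  show "higher x (mate y)" if "higher x y"
  proof (rule ccontr)
    assume "\<not> higher x (mate y)"
    with cmp have "higher (mate y) x" by blast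
    then have "col x \<le> col (mate y)" by (simp add: higher_def)
    with that m(3) ne show False by (simp add: higher_def)
  qed
  show "higher (mate y) x" if "higher y x"
  proof (rule ccontr)
    assume "\<not> higher (mate y) x"
    with cmp have "higher x (mate y)" by blast
    then have "col (mate y) \<le> col x" by (simp add: higher_def)
    with that m(3) ne show False by (simp add: higher_def)
  qed
qed

lemma paired_read_order:
  assumes "paired x"
  shows "level x = 0 \<Longrightarrow> higher x (mate x)" and "level x = 1 \<Longrightarrow> higher (mate x) x"
  using partner_levels[OF partner_mate[OF assms]] partner_mate[OF assms]
  by (auto simp: higher_def partner_def)

text \<open>The sum of the charges read before a free box, computed without reference to a listing.\<close>

definition height :: "'x \<Rightarrow> int" where
  "height x = (\<Sum>y | live y \<and> higher y x. charge y)"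

text \<open>The free box whose letter an operator changes. The two families of inequalities compare only free
  boxes, and by \<open>free_comparable\<close> they do not depend on a listing.\<close>

definition pivot :: "'x \<Rightarrow> bool" where
  "pivot x \<longleftrightarrow> free x \<and>
     (\<forall>y. free y \<and> higher y x \<longrightarrow> height x \<le> height y) \<and>
     (\<forall>y. free y \<and> higher x y \<longrightarrow> height x + charge x \<le> height y + charge y)"

lemma finite_live: "finite {y. live y \<and> P y}"
  by (rule finite_subset[OF _ finite_boxes]) (auto simp: live_def)

lemma height_diff:
  assumes "higher x y" "x \<in> Y" "y \<in> Y"
  shows "height y - height x = (\<Sum>z | live z \<and> higher z y \<and> \<not> higher z x. charge z)"
proof -
  let ?A = "{z. live z \<and> higher z x}" and ?B = "{z. live z \<and> higher z y \<and> \<not> higher z x}"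
  have "z \<in> {z. live z \<and> higher z y} \<longleftrightarrow> z \<in> ?A \<union> ?B" for z
  proof (cases "live z \<and> higher z x")
    case True
    then have "higher z y" using higher_trans[OF _ assms(1) _ assms(2)] by (simp add: live_def)
    with True show ?thesis by simp
  next
    case False
    then show ?thesis by auto
  qed
  then have "{z. live z \<and> higher z y} = ?A \<union> ?B"
    by (rule set_eqI)
  then have "height y = sum charge (?A \<union> ?B)"
    by (simp only: height_def)
  also have "\<dots> = height x + sum charge ?B"
    unfolding height_def by (rule sum.union_disjoint[OF finite_live finite_live]) blast
  finally show ?thesis by linarith
qed

lemma pivot_free: "pivot x \<Longrightarrow> free x"
  unfolding pivot_def by blast

lemma pivot_height_le: "pivot x \<Longrightarrow> free y \<Longrightarrow> higher y x \<Longrightarrow> height x \<le> height y"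
  unfolding pivot_def by blast

lemma pivot_height_charge_le:
  "pivot x \<Longrightarrow> free y \<Longrightarrow> higher x y \<Longrightarrow> height x + charge x \<le> height y + charge y"
  unfolding pivot_def by blast

lemma free_in: "free x \<Longrightarrow> x \<in> Y"
  by (simp add: free_def live_def)

lemma pivot_column:
  assumes "pivot x" "y \<in> Y" "col y = col x" "y \<noteq> x"
  shows "level y \<notin> {0, 1}"
proof
  assume "level y \<in> {0, 1}"
  with assms pivot_free[OF assms(1)] have "partner x y" by (simp add: free_def partner_def live_def)
  with pivot_free[OF assms(1)] show False by (auto simp: free_def)
qed

text \<open>A second \<open>a\<close> to the right would be free too, since a \<open>b\<close> below it would produce a \<open>b\<close> below \<open>x\<close>.
  Every live box read between the two lies in their row at level \<open>0\<close>, so the height at \<open>x\<close> would exceed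
  the height at \<open>y\<close>.\<close>

lemma pivot_row_right:
  assumes x: "pivot x" "level x = 0" and y: "y \<in> Y" "row y = row x" "col x < col y"
  shows "level y \<noteq> 0"
proof
  assume ly: "level y = 0"
  have X: "x \<in> Y" "free x" using pivot_free[OF x(1)] free_in by blast+
  have "free y"
  proof (rule ccontr)
    assume "\<not> free y"
    then obtain z where "partner y z" using y ly by (auto simp: free_def live_def)
    with partner_levels[OF this] ly have z: "z \<in> Y" "col z = col y" "level z = 1" "row y < row z"
      by (auto simp: partner_def live_def)
    then obtain w where w: "w \<in> Y" "row w = row z" "col w = col x"
      using corner_SW[of x z] X y by auto
    have "level x \<le> level w" "level w \<le> level z"
      using level_col_le[of x w] level_row_le[of w z] X w z y by auto
    then have "level w = 0 \<or> level w = 1" using z(3) x(2) by presburger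
    moreover have "w \<noteq> x" using w z y by auto
    ultimately show False using pivot_column[OF x(1) w(1,3)] by auto
  qed
  have yx: "higher y x" using y by (auto simp: higher_def)
  let ?S = "{z. live z \<and> higher z x \<and> \<not> higher z y}"
  have nn: "0 \<le> charge z" if "z \<in> ?S" for z
  proof -
    have "z = y \<or> higher y z" using free_comparable[OF \<open>free y\<close>, of z] that by auto
    then have "row z = row y" "col z \<le> col y" "z \<in> Y"
      using that y by (auto simp: higher_def live_def)
    then have "level z \<le> level y" using level_row_le[of z y] y by auto
    then show ?thesis using ly by (auto simp: charge_def)
  qed
  have "charge y \<le> (\<Sum>z\<in>?S. charge z)"
    by (rule member_le_sum) (use nn finite_live yx ly y in \<open>auto simp: live_def higher_def\<close>)
  then have "height y < height x"
    using height_diff[OF yx y(1) X(1)] ly by (simp add: charge_def)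
  with pivot_height_le[OF x(1) \<open>free y\<close> yx] show False by simp
qed

text \<open>The mirror image of \<open>pivot_row_right\<close>: the boxes between would all be closing brackets.\<close>

lemma pivot_row_left:
  assumes x: "pivot x" "level x = 1" and y: "y \<in> Y" "row y = row x" "col y < col x"
  shows "level y \<noteq> 1"
proof
  assume ly: "level y = 1"
  have X: "x \<in> Y" "free x" using pivot_free[OF x(1)] free_in by blast+
  have "free y"
  proof (rule ccontr)
    assume "\<not> free y"
    then obtain z where "partner y z" using y ly by (auto simp: free_def live_def)
    with partner_levels[OF this] ly have z: "z \<in> Y" "col z = col y" "level z = 0" "row z < row y"
      by (auto simp: partner_def live_def)
    then obtain w where w: "w \<in> Y" "row w = row z" "col w = col x"
      using corner_NE[of z x] X y by auto
    have "level w \<le> level x" "level z \<le> level w"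
      using level_col_le[of w x] level_row_le[of z w] X w z y by auto
    then have "level w = 0 \<or> level w = 1" using z(3) x(2) by presburger
    moreover have "w \<noteq> x" using w z y by auto
    ultimately show False using pivot_column[OF x(1) w(1,3)] by auto
  qed
  have xy: "higher x y" using y by (auto simp: higher_def)
  let ?S = "{z. live z \<and> higher z y \<and> \<not> higher z x}"
  have nn: "0 \<le> - charge z" if "z \<in> ?S" for z
  proof -
    have "z = x \<or> higher x z" using free_comparable[OF X(2), of z] that by auto
    then have "row z = row y" "col y \<le> col z" "z \<in> Y"
      using that y by (auto simp: higher_def live_def)
    then have "level y \<le> level z" using level_row_le[of y z] y by auto
    then show ?thesis using ly by (auto simp: charge_def)
  qed
  have "- charge x \<le> (\<Sum>z\<in>?S. - charge z)"
    by (rule member_le_sum[where f = "\<lambda>z. - charge z"])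
      (use nn finite_live xy x X in \<open>auto simp: live_def higher_def\<close>)
  then have "height y < height x"
    using height_diff[OF xy X(1) y(1)] x(2) by (simp add: charge_def sum_negf)
  moreover have "height x + charge x \<le> height y + charge y"
    by (rule pivot_height_charge_le[OF x(1) \<open>free y\<close> xy])
  ultimately show False using ly x(2) by (simp add: charge_def)
qed

end

section \<open>Admissible listings\<close>

locale listed_level_filling = level_filling +
  fixes xs :: "'a list"
  assumes distinct_xs: "distinct xs" and set_xs: "set xs = Y"
    and higher_imp_less: "\<And>r s. r < length xs \<Longrightarrow> s < length xs \<Longrightarrow> higher (xs ! r) (xs ! s) \<Longrightarrow> r < s"
begin

abbreviation before :: "nat \<Rightarrow> 'a set" where
  "before q \<equiv> set (take q xs)"

definition prefix_height :: "nat \<Rightarrow> int" where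
  "prefix_height q = (\<Sum>x\<in>before q. charge x)"

text \<open>The condition of \<open>flip\<close> at position \<open>p\<close>, expressed by partial sums: the walk is minimal at \<open>p\<close> among
  the earlier times, and minimal at \<open>Suc p\<close> among the later times.\<close>

definition active :: "nat \<Rightarrow> bool" where
  "active p \<longleftrightarrow> p < length xs \<and> live (xs ! p) \<and>
     (\<forall>q\<le>p. prefix_height p \<le> prefix_height q) \<and>
     (\<forall>q. p < q \<and> q \<le> length xs \<longrightarrow> prefix_height (Suc p) \<le> prefix_height q)"

definition free_height :: "nat \<Rightarrow> int" where
  "free_height q = (\<Sum>x | x \<in> before q \<and> free x. charge x)"

text \<open>The pairs cut by the time \<open>q\<close>, each represented by its member already read.\<close>

definition split_pairs :: "nat \<Rightarrow> 'a set" where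
  "split_pairs q = {x \<in> before q. paired x \<and> mate x \<notin> before q}"

lemma nth_in_Y: "t < length xs \<Longrightarrow> xs ! t \<in> Y"
  using nth_mem[of t xs] by (simp add: set_xs)

lemma in_before_iff: "x \<in> before q \<longleftrightarrow> (\<exists>t. t < q \<and> t < length xs \<and> x = xs ! t)"
  by (auto simp: in_set_conv_nth)

lemma nth_in_before_iff: "t < length xs \<Longrightarrow> xs ! t \<in> before q \<longleftrightarrow> t < q"
  using nth_eq_iff_index_eq[OF distinct_xs] unfolding in_before_iff by blast

lemma before_subset: "before q \<subseteq> Y"
  using set_take_subset[of q xs] by (simp add: set_xs)

lemma in_Y_nth: "x \<in> Y \<Longrightarrow> \<exists>t<length xs. x = xs ! t"
  unfolding set_xs[symmetric] by (auto simp: in_set_conv_nth)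

lemma before_higher:
  assumes "x \<in> before q" "y \<in> Y" "higher y x"
  shows "y \<in> before q"
proof -
  from assms(1) obtain t where t: "t < q" "t < length xs" "x = xs ! t" using in_before_iff by blast
  from in_Y_nth[OF assms(2)] obtain s where s: "s < length xs" "y = xs ! s" by blast
  have "s < t" using higher_imp_less[OF s(1) t(2)] assms(3) s t by simp
  with t s show ?thesis by (simp add: nth_in_before_iff)
qed

lemma mate_in: "paired x \<Longrightarrow> mate x \<in> Y"
  using partner_mate[of x] by (simp add: partner_def live_def)

lemma before_Suc: "q < length xs \<Longrightarrow> before (Suc q) = insert (xs ! q) (before q)"
  by (simp add: take_Suc_conv_app_nth)

lemma prefix_height_Suc: "q < length xs \<Longrightarrow> prefix_height (Suc q) = prefix_height q + charge (xs ! q)"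
  using nth_in_before_iff[of q q] by (simp add: prefix_height_def before_Suc)

lemma free_height_Suc:
  assumes "q < length xs" "\<not> free (xs ! q)"
  shows "free_height (Suc q) = free_height q"
proof -
  have "{x. x \<in> before (Suc q) \<and> free x} = {x. x \<in> before q \<and> free x}"
    using assms by (auto simp: before_Suc)
  then show ?thesis by (simp only: free_height_def)
qed

text \<open>In a pair the box at level \<open>0\<close> lies above the other and is therefore read first.\<close>

lemma charge_split_pairs:
  assumes "x \<in> split_pairs q"
  shows "charge x = 1"
proof -
  have x: "x \<in> before q" "paired x" "mate x \<notin> before q"
    using assms by (auto simp: split_pairs_def)
  have "\<not> higher (mate x) x" using before_higher[OF x(1) mate_in[OF x(2)]] x(3) by blast
  then have "level x \<noteq> 1" using paired_read_order(2)[OF x(2)] by blast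
  then have "level x = 0" using partner_levels[OF partner_mate[OF x(2)]] by blast
  then show ?thesis by (simp add: charge_def)
qed

text \<open>Complete pairs contribute \<open>0\<close>, and a pair that has been cut contributes \<open>1\<close>. So the pairs can only lift
  the walk above the walk of the free boxes; they never create a new minimum.\<close>

lemma prefix_height_eq: "prefix_height q = free_height q + int (card (split_pairs q))"
proof -
  let ?F = "{x. x \<in> before q \<and> free x}" and ?C = "{x \<in> before q. paired x \<and> mate x \<in> before q}"
  (* mate is an involution of the complete pairs that reverses the charge *)
  have "(\<Sum>x\<in>?C. charge x) = (\<Sum>x\<in>?C. charge (mate x))"
    by (rule sum.reindex_bij_witness[of _ mate mate]) (auto simp: mate_mate paired_mate)
  also have "\<dots> = (\<Sum>x\<in>?C. - charge x)"
    by (rule sum.cong) (auto simp: charge_mate)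
  finally have C: "(\<Sum>x\<in>?C. charge x) = 0" by (simp add: sum_negf)
  have "(\<Sum>x\<in>split_pairs q. charge x) = (\<Sum>x\<in>split_pairs q. 1)"
    by (rule sum.cong) (simp_all add: charge_split_pairs)
  then have S: "(\<Sum>x\<in>split_pairs q. charge x) = int (card (split_pairs q))" by simp
  have fin: "finite (split_pairs q)" by (simp add: split_pairs_def)
  have "prefix_height q = (\<Sum>x\<in>?F \<union> (?C \<union> split_pairs q). charge x)"
    unfolding prefix_height_def
  proof (rule sum.mono_neutral_right)
    show "\<forall>x\<in>before q - (?F \<union> (?C \<union> split_pairs q)). charge x = 0"
    proof
      fix x assume "x \<in> before q - (?F \<union> (?C \<union> split_pairs q))"
      then have "x \<in> before q" "\<not> free x" "\<not> paired x" by (auto simp: split_pairs_def)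
      then show "charge x = 0" using before_subset[of q] live_or_uncharged[of x] live_iff[of x] by blast
    qed
  qed (auto simp: split_pairs_def)
  also have "\<dots> = (\<Sum>x\<in>?F. charge x) + (\<Sum>x\<in>?C \<union> split_pairs q. charge x)"
    by (rule sum.union_disjoint) (use fin in \<open>auto simp: split_pairs_def dest: free_not_paired\<close>)
  also have "(\<Sum>x\<in>?C \<union> split_pairs q. charge x) = (\<Sum>x\<in>?C. charge x) + (\<Sum>x\<in>split_pairs q. charge x)"
    by (rule sum.union_disjoint) (use fin in \<open>auto simp: split_pairs_def\<close>)
  finally show ?thesis unfolding C S free_height_def by simp
qed

lemma free_height_le: "free_height q \<le> prefix_height q"
  by (simp add: prefix_height_eq)

lemma split_pairs_ends: "split_pairs 0 = {}" "split_pairs (length xs) = {}"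
  using mate_in set_xs by (auto simp: split_pairs_def)

lemma higher_of_before_free:
  assumes "q < length xs" "free (xs ! q)" "x \<in> before q" "live x"
  shows "higher x (xs ! q)"
proof -
  obtain t where t: "t < q" "t < length xs" "x = xs ! t" using assms(3) in_before_iff by blast
  have "xs ! q \<noteq> x" using t assms(1) distinct_xs by (simp add: nth_eq_iff_index_eq)
  moreover have "\<not> higher (xs ! q) x" using higher_imp_less[of q t] t assms(1) by auto
  ultimately show ?thesis using free_comparable[OF assms(2,4)] by blast
qed

text \<open>Immediately before and after a free box no pair is cut, because the two members of a pair lie on
  the same side of it.\<close>

lemma split_pairs_free:
  assumes q: "q < length xs" "free (xs ! q)"
  shows "split_pairs q = {}" and "split_pairs (Suc q) = {}"
proof -
  have mate: "mate x \<in> before q" if x: "x \<in> before q" "paired x" for x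
  proof -
    have "higher (mate x) (xs ! q)"
      using mate_same_side(2)[OF q(2) x(2)] higher_of_before_free[OF q x(1)] x(2) live_iff
      by blast
    moreover obtain s where "s < length xs" "mate x = xs ! s"
      using in_Y_nth[OF mate_in[OF x(2)]] by blast
    ultimately show ?thesis using higher_imp_less[of s q] q(1) by (auto simp: nth_in_before_iff)
  qed
  then show "split_pairs q = {}" by (auto simp: split_pairs_def)
  show "split_pairs (Suc q) = {}"
    using mate free_not_paired[OF q(2)] by (auto simp: split_pairs_def before_Suc[OF q(1)])
qed

text \<open>From any time one can move forward (or, in \<open>previous_free\<close>, backward) past paired and irrelevant
  boxes to a time at which no pair is cut. The free walk does not change on the way, so the true walk
  weakly descends to it.\<close>

lemma next_free:
  assumes "q \<le> length xs"
  shows "\<exists>q'. q \<le> q' \<and> q' \<le> length xs \<and> prefix_height q' = free_height q \<and>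
    (q' = length xs \<or> free (xs ! q')) \<and> (\<forall>t. q \<le> t \<and> t < q' \<longrightarrow> \<not> free (xs ! t))"
  using assms
proof (induction rule: inc_induct)
  case base
  then show ?case
    by (intro exI[of _ "length xs"]) (auto simp: prefix_height_eq split_pairs_ends)
next
  case (step q)
  show ?case
  proof (cases "free (xs ! q)")
    case True
    then show ?thesis using step.hyps
      by (intro exI[of _ q]) (auto simp: prefix_height_eq split_pairs_free)
  next
    case False
    from step.IH obtain q' where q': "Suc q \<le> q'" "q' \<le> length xs" "prefix_height q' = free_height (Suc q)"
      "q' = length xs \<or> free (xs ! q')" "\<And>t. Suc q \<le> t \<Longrightarrow> t < q' \<Longrightarrow> \<not> free (xs ! t)"
      by blast
    have "\<not> free (xs ! t)" if "q \<le> t" "t < q'" for t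
      using False q'(5)[of t] that by (cases "t = q") auto
    then show ?thesis using q' free_height_Suc[OF _ False] step.hyps
      by (intro exI[of _ q']) auto
  qed
qed

lemma previous_free:
  assumes "q \<le> length xs"
  shows "\<exists>q'\<le>q. prefix_height q' = free_height q \<and>
    (q' = 0 \<or> free (xs ! (q' - 1))) \<and> (\<forall>t. q' \<le> t \<and> t < q \<longrightarrow> \<not> free (xs ! t))"
  using assms
proof (induction q)
  case 0
  then show ?case by (auto simp: prefix_height_eq split_pairs_ends)
next
  case (Suc q)
  show ?case
  proof (cases "free (xs ! q)")
    case True
    then show ?thesis using Suc.prems
      by (intro exI[of _ "Suc q"]) (auto simp: prefix_height_eq split_pairs_free)
  next
    case False
    from Suc obtain q' where q': "q' \<le> q" "prefix_height q' = free_height q"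
      "q' = 0 \<or> free (xs ! (q' - 1))" "\<And>t. q' \<le> t \<Longrightarrow> t < q \<Longrightarrow> \<not> free (xs ! t)"
      by auto
    have "\<not> free (xs ! t)" if "q' \<le> t" "t < Suc q" for t
      using False q'(4)[of t] that by (cases "t = q") auto
    then show ?thesis using q' free_height_Suc[OF _ False] Suc.prems
      by (intro exI[of _ q']) auto
  qed
qed

lemma prefix_height_free:
  assumes q: "q < length xs" "free (xs ! q)"
  shows "prefix_height q = height (xs ! q)"
proof -
  have "{y. live y \<and> higher y (xs ! q)} = {y \<in> before q. live y}"
  proof (intro set_eqI iffI)
    fix y assume "y \<in> {y. live y \<and> higher y (xs ! q)}"
    then have y: "live y" "higher y (xs ! q)" by auto
    then obtain s where "s < length xs" "y = xs ! s"
      using in_Y_nth[of y] by (auto simp: live_def)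
    then show "y \<in> {y \<in> before q. live y}"
      using y higher_imp_less[of s q] q(1) by (auto simp: nth_in_before_iff)
  next
    fix y assume "y \<in> {y \<in> before q. live y}"
    then show "y \<in> {y. live y \<and> higher y (xs ! q)}"
      using higher_of_before_free[OF q] by blast
  qed
  moreover have "prefix_height q = (\<Sum>y\<in>{y \<in> before q. live y}. charge y)"
    unfolding prefix_height_def
    by (rule sum.mono_neutral_right) (use before_subset live_or_uncharged in \<open>auto simp: subset_iff\<close>)
  ultimately show ?thesis by (simp only: height_def)
qed

lemma split_pairs_imp_less: "x \<in> split_pairs q \<Longrightarrow> free_height q < prefix_height q"
proof -
  assume "x \<in> split_pairs q"
  moreover have "finite (split_pairs q)" by (simp add: split_pairs_def)
  ultimately have "0 < card (split_pairs q)" by (auto simp: card_gt_0_iff)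
  then show ?thesis by (simp add: prefix_height_eq)
qed

text \<open>If the changed box had a mate, that pair would be cut just after (level \<open>0\<close>) or just before
  (level \<open>1\<close>) it, and moving on to the nearest uncut time would bring the walk strictly lower.\<close>

lemma active_imp_free:
  assumes "active p"
  shows "free (xs ! p)"
proof (rule ccontr)
  let ?x = "xs ! p"
  assume nf: "\<not> free ?x"
  have p: "p < length xs" and live: "live ?x"
    and left: "\<And>q. q \<le> p \<Longrightarrow> prefix_height p \<le> prefix_height q"
    and right: "\<And>q. p < q \<Longrightarrow> q \<le> length xs \<Longrightarrow> prefix_height (Suc p) \<le> prefix_height q"
    using assms by (simp_all add: active_def)
  from nf live have pair: "paired ?x" using live_iff by blast
  obtain s where s: "s < length xs" "mate ?x = xs ! s"
    using in_Y_nth[OF mate_in[OF pair]] by blast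
  from partner_levels[OF partner_mate[OF pair]] have "level ?x = 0 \<or> level ?x = 1" by blast
  then show False
  proof
    assume "level ?x = 0"
    then have "p < s" using higher_imp_less[of p s] paired_read_order(1)[OF pair] p s by simp
    then have "?x \<in> split_pairs (Suc p)"
      using pair p s by (simp add: split_pairs_def nth_in_before_iff)
    then have "free_height (Suc p) < prefix_height (Suc p)" by (rule split_pairs_imp_less)
    moreover obtain q' where "Suc p \<le> q'" "q' \<le> length xs" "prefix_height q' = free_height (Suc p)"
      using next_free[of "Suc p"] p by auto
    ultimately show False using right[of q'] by simp
  next
    assume "level ?x = 1"
    then have "s < p" using higher_imp_less[of s p] paired_read_order(2)[OF pair] p s by simp
    then have "mate ?x \<in> split_pairs p"
      using pair p s paired_mate[OF pair] mate_mate[OF pair]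
      by (simp add: split_pairs_def nth_in_before_iff)
    then have "free_height p < prefix_height p" by (rule split_pairs_imp_less)
    moreover obtain q' where "q' \<le> p" "prefix_height q' = free_height p"
      using previous_free[of p] p by auto
    ultimately show False using left[of q'] by simp
  qed
qed

text \<open>The reading enters the left-hand side only: it suffices to compare the walk at the free boxes, where
  it equals the height, and there the order of reading is forced.\<close>

theorem active_iff_pivot:
  assumes p: "p < length xs"
  shows "active p \<longleftrightarrow> pivot (xs ! p)"
proof
  assume act: "active p"
  note fr = active_imp_free[OF act]
  show "pivot (xs ! p)"
    unfolding pivot_def
  proof (intro conjI allI impI fr)
    fix y assume y: "free y \<and> higher y (xs ! p)"
    then obtain q where q: "q < length xs" "y = xs ! q"
      using in_Y_nth[of y] free_in[of y] by blast
    then have "q < p" using y higher_imp_less[of q p] p by blast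
    then have "prefix_height p \<le> prefix_height q" using act by (simp add: active_def)
    then show "height (xs ! p) \<le> height y"
      using prefix_height_free p q y fr by simp
  next
    fix y assume y: "free y \<and> higher (xs ! p) y"
    then obtain q where q: "q < length xs" "y = xs ! q"
      using in_Y_nth[of y] free_in[of y] by blast
    then have "p < q" using y higher_imp_less[of p q] p by blast
    then have "prefix_height (Suc p) \<le> prefix_height (Suc q)" using act q by (simp add: active_def)
    then show "height (xs ! p) + charge (xs ! p) \<le> height y + charge y"
      using prefix_height_free p q y fr by (simp add: prefix_height_Suc)
  qed
next
  assume piv: "pivot (xs ! p)"
  note fr = pivot_free[OF piv]
  have Hp: "prefix_height p = height (xs ! p)" by (rule prefix_height_free[OF p fr])
  have free_higher: "higher (xs ! r) (xs ! s)" if "r < s" "s < length xs" "free (xs ! r)" "free (xs ! s)" for r s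
    using higher_of_before_free[of s "xs ! r"] that live_iff by (simp add: nth_in_before_iff)
  show "active p"
    unfolding active_def
  proof (intro conjI allI impI p)
    show "live (xs ! p)" using fr live_iff by blast
  next
    fix q assume "q \<le> p"
    then obtain q' where q': "q \<le> q'" "prefix_height q' = free_height q"
      "q' = length xs \<or> free (xs ! q')" "\<And>t. q \<le> t \<Longrightarrow> t < q' \<Longrightarrow> \<not> free (xs ! t)" "q' \<le> length xs"
      using next_free[of q] p by auto
    (* the search stops at p at the latest, as p itself carries a free box *)
    have "q' \<le> p" using q'(4)[of p] fr \<open>q \<le> p\<close> by (meson not_le)
    then have fq: "free (xs ! q')" using q'(3) p by auto
    have "height (xs ! p) \<le> height (xs ! q')"
    proof (cases "q' = p")
      case False
      then show ?thesis
        using pivot_height_le[OF piv fq] free_higher[of q' p] \<open>q' \<le> p\<close> p fr fq by simp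
    qed simp
    then have "prefix_height p \<le> prefix_height q'"
      using Hp prefix_height_free[OF _ fq] \<open>q' \<le> p\<close> p by simp
    then show "prefix_height p \<le> prefix_height q" using q'(2) free_height_le[of q] by simp
  next
    fix q assume q: "p < q \<and> q \<le> length xs"
    then obtain q' where q': "q' \<le> q" "prefix_height q' = free_height q"
      "q' = 0 \<or> free (xs ! (q' - 1))" "\<And>t. q' \<le> t \<Longrightarrow> t < q \<Longrightarrow> \<not> free (xs ! t)"
      using previous_free[of q] by auto
    have "p < q'" using q'(4)[of p] fr q by (meson not_le)
    then obtain r where r: "q' = Suc r" "p \<le> r" by (cases q') auto
    then have fr': "free (xs ! r)" and r': "r < length xs" using q'(1,3) q by auto
    have "height (xs ! p) + charge (xs ! p) \<le> height (xs ! r) + charge (xs ! r)"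
    proof (cases "r = p")
      case False
      then show ?thesis
        using pivot_height_charge_le[OF piv fr'] free_higher[of p r] r r' fr fr' by simp
    qed simp
    then have "prefix_height (Suc p) \<le> prefix_height q'"
      using Hp prefix_height_free[OF r' fr'] r p r' by (simp add: prefix_height_Suc)
    then show "prefix_height (Suc p) \<le> prefix_height q" using q'(2) free_height_le[of q] by simp
  qed
qed

end

lemma map_update_distinct:
  assumes "distinct xs" "p < length xs"
  shows "map (T(xs ! p := c)) xs = (map T xs)[p := c]"
  using assms by (intro nth_equalityI) (auto simp: nth_list_update nth_eq_iff_index_eq)

context listed_level_filling
begin

lemma active_iff_word:
  assumes ab: "a \<noteq> b" and charge: "\<And>x. x \<in> Y \<Longrightarrow> charge x = sign a b (T x)"
    and p: "p < length xs"
  shows "active p \<longleftrightarrow> T (xs ! p) \<in> {a, b} \<and> excess a b (take p (map T xs)) = 0 \<and>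
    deficit a b (drop (Suc p) (map T xs)) = 0"
proof -
  let ?s = "\<lambda>w. \<Sum>x\<leftarrow>w. sign a b x" and ?w = "map T xs"
  have H: "prefix_height q = ?s (take q ?w)" for q
  proof -
    have "prefix_height q = (\<Sum>x\<leftarrow>take q xs. charge x)"
      using distinct_xs by (simp add: prefix_height_def sum_list_distinct_conv_sum_set)
    also have "\<dots> = (\<Sum>x\<leftarrow>take q xs. sign a b (T x))"
      using before_subset[of q] charge by (intro arg_cong[of _ _ sum_list] map_cong) auto
    finally show ?thesis by (simp add: take_map o_def)
  qed
  have app: "?s (u @ v) = ?s u + ?s v" for u v by simp
  (* the two conditions of flip bound suffix sums before p and prefix sums after p; both are
     differences of values of the walk *)
  have drop: "?s (drop q (take p ?w)) = prefix_height p - prefix_height q" if "q \<le> p" for q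
    using app[of "take q (take p ?w)" "drop q (take p ?w)"] that
    by (simp only: H append_take_drop_id) (simp add: min_def)
  have take: "?s (take q (drop (Suc p) ?w)) = prefix_height (Suc p + q) - prefix_height (Suc p)" for q
    by (simp only: H take_add app)
  have "live (xs ! p) \<longleftrightarrow> T (xs ! p) \<in> {a, b}"
  proof -
    have "live (xs ! p) \<longleftrightarrow> charge (xs ! p) \<noteq> 0"
      using nth_in_Y[OF p] by (simp add: live_def charge_def)
    then show ?thesis using charge[OF nth_in_Y[OF p]] by (simp add: sign_def)
  qed
  moreover have "excess a b (take p ?w) = 0 \<longleftrightarrow> (\<forall>q\<le>p. prefix_height p \<le> prefix_height q)"
  proof -
    have "?s (drop q (take p ?w)) = 0" if "\<not> q \<le> p" for q using that by simp
    then show ?thesis unfolding excess_eq_0_iff using drop by (metis diff_le_0_iff_le order_refl)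
  qed
  moreover have "deficit a b (drop (Suc p) ?w) = 0 \<longleftrightarrow>
      (\<forall>q. p < q \<and> q \<le> length xs \<longrightarrow> prefix_height (Suc p) \<le> prefix_height q)"
    (is "_ \<longleftrightarrow> ?R")
  proof
    assume "deficit a b (drop (Suc p) ?w) = 0"
    then have "0 \<le> prefix_height (Suc p + q) - prefix_height (Suc p)" for q
      unfolding deficit_eq_0_iff take by blast
    moreover have "q = Suc p + (q - Suc p)" if "p < q" for q using that by simp
    ultimately show ?R by (metis diff_ge_0_iff_ge)
  next
    assume R: ?R
    have "prefix_height (Suc p) \<le> prefix_height (Suc p + q)" for q
    proof (cases "Suc p + q \<le> length xs")
      case True
      then show ?thesis using R by simp
    next
      case False
      then have "prefix_height (Suc p + q) = prefix_height (length xs)" by (simp add: prefix_height_def)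
      then show ?thesis using R p by simp
    qed
    then show "deficit a b (drop (Suc p) ?w) = 0"
      unfolding deficit_eq_0_iff take by simp
  qed
  ultimately show ?thesis unfolding active_def using p by blast
qed

lemma flip_word_iff:
  assumes "a \<noteq> b" and "\<And>x. x \<in> Y \<Longrightarrow> charge x = sign a b (T x)"
  shows "flip a b (map T xs) w \<longleftrightarrow>
      (\<exists>x\<in>Y. pivot x \<and> T x = a \<and> w = map (T(x := b)) xs)"
    and "flip a b w (map T xs) \<longleftrightarrow>
      (\<exists>x\<in>Y. pivot x \<and> T x = b \<and> w = map (T(x := a)) xs)"
proof -
  have act: "excess a b (take p (map T xs)) = 0 \<and> deficit a b (drop (Suc p) (map T xs)) = 0 \<longleftrightarrow>
      pivot (xs ! p)" if "p < length xs" "T (xs ! p) \<in> {a, b}" for p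
    using active_iff_word[OF assms that(1)] active_iff_pivot[OF that(1)] that(2) by blast
  have ball: "(\<exists>x\<in>Y. P x) \<longleftrightarrow> (\<exists>p<length xs. P (xs ! p))" for P
    using in_Y_nth nth_in_Y by blast
  have upd: "map (T(xs ! p := c)) xs = (map T xs)[p := c]" if "p < length xs" for p c
    using map_update_distinct[OF distinct_xs that] .
  show "flip a b (map T xs) w \<longleftrightarrow> (\<exists>x\<in>Y. pivot x \<and> T x = a \<and> w = map (T(x := b)) xs)"
    unfolding flip_left_iff_nth ball length_map
    by (rule ex_cong1, rule conj_cong[OF refl]) (use act upd in auto)
  show "flip a b w (map T xs) \<longleftrightarrow> (\<exists>x\<in>Y. pivot x \<and> T x = b \<and> w = map (T(x := a)) xs)"
    unfolding flip_right_iff_nth ball length_map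
    by (rule ex_cong1, rule conj_cong[OF refl]) (use act upd in auto)
qed

end

section \<open>Operators on tableaux\<close>

text \<open>Both claims about an operator \<open>g\<close> on words at once: on the readings of \<open>T\<close> it is induced by a value
  \<open>T'\<close> that is semistandard (or \<open>0\<close>), and that is chosen before the reading.\<close>

definition lifts :: "nat \<Rightarrow> nat \<Rightarrow> box set \<Rightarrow> tableau \<Rightarrow> (letter list \<Rightarrow> letter list option) \<Rightarrow> bool" where
  "lifts m n Y T g \<longleftrightarrow> (\<exists>T'. set_option T' \<subseteq> semistandard_tableaux m n Y \<and>
     (\<forall>xs. listing Y xs \<and> admissible xs \<longrightarrow> g (reading xs T) = map_option (reading xs) T'))"

text \<open>An operator lifts as soon as the box that it changes is characterised by a property \<open>P\<close> not involving
  the reading. Uniqueness of that box is automatic, since \<open>g\<close> has only one value.\<close>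

lemma lifts_replace:
  assumes g: "\<And>xs w. listing Y xs \<Longrightarrow> admissible xs \<Longrightarrow> g (map T xs) = Some w \<longleftrightarrow>
      (\<exists>x\<in>Y. P x \<and> w = map (T(x := c)) xs)"
    and P: "\<And>x. x \<in> Y \<Longrightarrow> P x \<Longrightarrow> T(x := c) \<in> semistandard_tableaux m n Y"
  shows "lifts m n Y T g"
proof (cases "\<exists>x\<in>Y. P x")
  case True
  then obtain x where x: "x \<in> Y" "P x" by blast
  have "g (reading xs T) = map_option (reading xs) (Some (T(x := c)))"
    if "listing Y xs" "admissible xs" for xs
  proof -
    have "g (map T xs) = Some (map (T(x := c)) xs)" using g[OF that] x by blast
    then show ?thesis by (simp add: reading_def)
  qed
  with P[OF x] show ?thesis unfolding lifts_def by (intro exI[of _ "Some (T(x := c))"]) simp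
next
  case False
  have "g (reading xs T) = map_option (reading xs) None" if "listing Y xs" "admissible xs" for xs
  proof -
    have "g (map T xs) \<noteq> Some w" for w using g[OF that] False by blast
    then have "g (map T xs) = None" by (meson option.exhaust)
    then show ?thesis by (simp add: reading_def)
  qed
  then show ?thesis unfolding lifts_def by (intro exI[of _ None]) simp
qed

lemma listing_length: "listing Y xs \<Longrightarrow> length xs = card Y"
  by (auto simp: listing_def distinct_card)

lemma lifts_flip:
  assumes "level_filling Y row col level"
    and higher: "\<And>x y. level_filling.higher row col x y \<longleftrightarrow> strictly_higher x y"
    and ab: "a \<noteq> b"
    and charge: "\<And>x. x \<in> Y \<Longrightarrow> level_filling.charge level x = sign a b (T x)"
  shows "(\<And>w y. length w = card Y \<Longrightarrow> g w = Some y \<longleftrightarrow> flip a b w y) \<Longrightarrow>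
      (\<And>x. level_filling.pivot Y row col level x \<Longrightarrow> x \<in> Y \<Longrightarrow> T x = a \<Longrightarrow>
        T(x := b) \<in> semistandard_tableaux m n Y) \<Longrightarrow> lifts m n Y T g"
    and "(\<And>w y. length w = card Y \<Longrightarrow> g w = Some y \<longleftrightarrow> flip a b y w) \<Longrightarrow>
      (\<And>x. level_filling.pivot Y row col level x \<Longrightarrow> x \<in> Y \<Longrightarrow> T x = b \<Longrightarrow>
        T(x := a) \<in> semistandard_tableaux m n Y) \<Longrightarrow> lifts m n Y T g"
proof -
  interpret level_filling Y row col level by fact
  have listed: "listed_level_filling Y row col level xs" if "listing Y xs" "admissible xs" for xs
    by unfold_locales (use that in \<open>auto simp: listing_def admissible_def higher\<close>)
  have len: "length (map T xs) = card Y" if "listing Y xs" for xs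
    using listing_length[OF that] by simp
  {
    assume g: "\<And>w y. length w = card Y \<Longrightarrow> g w = Some y \<longleftrightarrow> flip a b w y"
      and st: "\<And>x. pivot x \<Longrightarrow> x \<in> Y \<Longrightarrow> T x = a \<Longrightarrow> T(x := b) \<in> semistandard_tableaux m n Y"
    show "lifts m n Y T g"
    proof (rule lifts_replace[where P = "\<lambda>x. pivot x \<and> T x = a" and c = b])
      fix xs w assume xs: "listing Y xs" "admissible xs"
      interpret listed_level_filling Y row col level xs by (rule listed[OF xs])
      show "g (map T xs) = Some w \<longleftrightarrow> (\<exists>x\<in>Y. (pivot x \<and> T x = a) \<and> w = map (T(x := b)) xs)"
        using g[OF len[OF xs(1)], of w] flip_word_iff(1)[OF ab charge, of w] by simp
    qed (use st in blast)
  }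
  {
    assume g: "\<And>w y. length w = card Y \<Longrightarrow> g w = Some y \<longleftrightarrow> flip a b y w"
      and st: "\<And>x. pivot x \<Longrightarrow> x \<in> Y \<Longrightarrow> T x = b \<Longrightarrow> T(x := a) \<in> semistandard_tableaux m n Y"
    show "lifts m n Y T g"
    proof (rule lifts_replace[where P = "\<lambda>x. pivot x \<and> T x = b" and c = a])
      fix xs w assume xs: "listing Y xs" "admissible xs"
      interpret listed_level_filling Y row col level xs by (rule listed[OF xs])
      show "g (map T xs) = Some w \<longleftrightarrow> (\<exists>x\<in>Y. (pivot x \<and> T x = b) \<and> w = map (T(x := a)) xs)"
        using g[OF len[OF xs(1)], of w] flip_word_iff(2)[OF ab charge, of w] by simp
    qed (use st in blast)
  }
qed

lemma skew_finite: "skew_young_diagram Y \<Longrightarrow> finite Y"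
  by (auto simp: skew_young_diagram_def young_diagram_def)

lemma skew_corners:
  assumes "skew_young_diagram Y" "(i, j) \<in> Y" "(i', j') \<in> Y" "i \<le> i'" "j \<le> j'"
  shows "(i', j) \<in> Y" and "(i, j') \<in> Y"
proof -
  obtain D E where D: "young_diagram D" and E: "young_diagram E" and Y: "Y = D - E"
    using assms(1) by (auto simp: skew_young_diagram_def)
  have "(i', j) \<in> D" "(i, j') \<in> D"
    using D assms(3-5) unfolding Y young_diagram_def by blast+
  moreover have "(i', j) \<notin> E" "(i, j') \<notin> E"
    using E assms(2,4,5) unfolding Y young_diagram_def by blast+
  ultimately show "(i', j) \<in> Y" "(i, j') \<in> Y" by (simp_all add: Y)
qed

lemma tableau_in_letters: "T \<in> semistandard_tableaux m n Y \<Longrightarrow> x \<in> Y \<Longrightarrow> T x \<in> letters m n"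
  by (auto simp: semistandard_tableaux_def)

lemma tableau_row:
  assumes "T \<in> semistandard_tableaux m n Y" "(i, j) \<in> Y" "(i, j') \<in> Y" "j < j'"
  shows "T (i, j) \<le> T (i, j')" and "T (i, j) = T (i, j') \<Longrightarrow> T (i, j) \<in> letters_plus m"
  using assms unfolding semistandard_tableaux_def by blast+

lemma tableau_column:
  assumes "T \<in> semistandard_tableaux m n Y" "(i, j) \<in> Y" "(i', j) \<in> Y" "i < i'"
  shows "T (i, j) \<le> T (i', j)" and "T (i, j) = T (i', j) \<Longrightarrow> T (i, j) \<in> letters_minus n"
  using assms unfolding semistandard_tableaux_def by blast+

lemma tableau_update:
  assumes T: "T \<in> semistandard_tableaux m n Y" and x: "(i, j) \<in> Y" and c: "c \<in> letters m n"
    and left: "\<And>j'. (i, j') \<in> Y \<Longrightarrow> j' < j \<Longrightarrow> T (i, j') < c \<or> T (i, j') = c \<and> c \<in> letters_plus m"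
    and right: "\<And>j'. (i, j') \<in> Y \<Longrightarrow> j < j' \<Longrightarrow> c < T (i, j') \<or> T (i, j') = c \<and> c \<in> letters_plus m"
    and above: "\<And>i'. (i', j) \<in> Y \<Longrightarrow> i' < i \<Longrightarrow> T (i', j) < c \<or> T (i', j) = c \<and> c \<in> letters_minus n"
    and below: "\<And>i'. (i', j) \<in> Y \<Longrightarrow> i < i' \<Longrightarrow> c < T (i', j) \<or> T (i', j) = c \<and> c \<in> letters_minus n"
  shows "T((i, j) := c) \<in> semistandard_tableaux m n Y"
proof -
  let ?T = "T((i, j) := c)"
  have "?T \<in> Y \<rightarrow>\<^sub>E letters m n"
    using T x c by (auto simp: semistandard_tableaux_def PiE_iff extensional_def)
  moreover have "?T (p, q) \<le> ?T (p, q') \<and> (?T (p, q) = ?T (p, q') \<longrightarrow> ?T (p, q) \<in> letters_plus m)"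
    if pq: "(p, q) \<in> Y" "(p, q') \<in> Y" "q < q'" for p q q'
  proof -
    consider "(p, q) = (i, j)" | "(p, q') = (i, j)" | "(p, q) \<noteq> (i, j)" "(p, q') \<noteq> (i, j)" by blast
    then show ?thesis
    proof cases
      case 1
      then have "c < T (i, q') \<or> T (i, q') = c \<and> c \<in> letters_plus m" using right pq by auto
      then show ?thesis using 1 pq by auto
    next
      case 2
      then have "T (i, q) < c \<or> T (i, q) = c \<and> c \<in> letters_plus m" using left pq by auto
      then show ?thesis using 2 pq by auto
    next
      case 3
      then show ?thesis using tableau_row[OF T pq] by auto
    qed
  qed
  moreover have "?T (p, q) \<le> ?T (p', q) \<and> (?T (p, q) = ?T (p', q) \<longrightarrow> ?T (p, q) \<in> letters_minus n)"
    if pq: "(p, q) \<in> Y" "(p', q) \<in> Y" "p < p'" for p p' q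
  proof -
    consider "(p, q) = (i, j)" | "(p', q) = (i, j)" | "(p, q) \<noteq> (i, j)" "(p', q) \<noteq> (i, j)" by blast
    then show ?thesis
    proof cases
      case 1
      then have "c < T (p', j) \<or> T (p', j) = c \<and> c \<in> letters_minus n" using below pq by auto
      then show ?thesis using 1 pq by auto
    next
      case 2
      then have "T (p, j) < c \<or> T (p, j) = c \<and> c \<in> letters_minus n" using above pq by auto
      then show ?thesis using 2 pq by auto
    next
      case 3
      then show ?thesis using tableau_column[OF T pq] by auto
    qed
  qed
  ultimately show ?thesis unfolding semistandard_tableaux_def by blast
qed

text \<open>Numberings of all letters, increasing for \<open>level_Bar\<close> and decreasing for \<open>level_Pos\<close>, in which the two
  letters moved by the index get the values \<open>0\<close> and \<open>1\<close>. The shift by \<open>k + 2\<close> keeps the letters of the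
  other kind above these values.\<close>

fun level_Bar :: "nat \<Rightarrow> letter \<Rightarrow> int" where
  "level_Bar k (Bar j) = int k + 1 - int j"
| "level_Bar k (Pos j) = int k + 2 + int j"

fun level_Pos :: "nat \<Rightarrow> letter \<Rightarrow> int" where
  "level_Pos k (Pos j) = int k + 1 - int j"
| "level_Pos k (Bar j) = int k + 2 + int j"

lemma level_Bar_mono: "x \<le> y \<Longrightarrow> level_Bar k x \<le> level_Bar k y"
  by (cases x; cases y) auto

lemma level_Bar_strict: "x < y \<Longrightarrow> level_Bar k x < level_Bar k y"
  by (cases x; cases y) (auto simp: less_letter_def)

lemma level_Pos_mono: "x \<le> y \<Longrightarrow> level_Pos k y \<le> level_Pos k x"
  by (cases x; cases y) auto

lemma level_Pos_strict: "x < y \<Longrightarrow> level_Pos k y < level_Pos k x"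
  by (cases x; cases y) (auto simp: less_letter_def)

lemma level_Pos_letters_plus: "x \<in> letters_plus m \<Longrightarrow> 0 < k \<Longrightarrow> level_Pos k x \<notin> {0, 1}"
  by (auto simp: letters_plus_def)

lemma level_Bar_letters_minus: "x \<in> letters_minus n \<Longrightarrow> 0 < k \<Longrightarrow> level_Bar k x \<notin> {0, 1}"
  by (auto simp: letters_minus_def)

lemma level_filling_Bar:
  assumes Y: "skew_young_diagram Y" and T: "T \<in> semistandard_tableaux m n Y" and k: "1 \<le> k"
  shows "level_filling Y (\<lambda>x. int (fst x)) (\<lambda>x. int (snd x)) (\<lambda>x. level_Bar k (T x))"
proof
  show "finite Y" using Y by (rule skew_finite)
next
  fix x y :: box
  assume "int (fst x) = int (fst y)" "int (snd x) = int (snd y)"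
  then show "x = y" by (simp add: prod_eq_iff)
next
  fix x y assume "x \<in> Y" "y \<in> Y" "int (fst x) \<le> int (fst y)" "int (snd x) \<le> int (snd y)"
  then have "(fst y, snd x) \<in> Y" "(fst x, snd y) \<in> Y"
    using skew_corners[OF Y, of "fst x" "snd x" "fst y" "snd y"] by auto
  then show "\<exists>z\<in>Y. int (fst z) = int (fst y) \<and> int (snd z) = int (snd x)"
    "\<exists>z\<in>Y. int (fst z) = int (fst x) \<and> int (snd z) = int (snd y)"
    by (auto intro: bexI[rotated])
next
  fix x y assume "x \<in> Y" "y \<in> Y" "int (fst x) = int (fst y)" "int (snd x) < int (snd y)"
  then have "T x \<le> T y"
    using tableau_row(1)[OF T, of "fst x" "snd x" "snd y"] by (cases x; cases y) auto
  then show "level_Bar k (T x) \<le> level_Bar k (T y)" by (rule level_Bar_mono)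
next
  fix x y assume "x \<in> Y" "y \<in> Y" "int (snd x) = int (snd y)" "int (fst x) < int (fst y)"
  then have "T x \<le> T y" "T x = T y \<Longrightarrow> T x \<in> letters_minus n"
    using tableau_column[OF T, of "fst x" "snd x" "fst y"] by (cases x; cases y; simp)+
  then show "level_Bar k (T x) < level_Bar k (T y) \<or>
      level_Bar k (T x) = level_Bar k (T y) \<and> level_Bar k (T x) \<notin> {0, 1}"
    using level_Bar_strict[of "T x" "T y" k] level_Bar_letters_minus[of "T x" n k] k
    by (cases "T x = T y") (auto simp: order_less_le)
qed

text \<open>The reflected coordinates: a row of the diagram, read from right to left, becomes a column of the filling.\<close>

lemma level_filling_Pos:
  assumes Y: "skew_young_diagram Y" and T: "T \<in> semistandard_tableaux m n Y" and k: "1 \<le> k"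
  shows "level_filling Y (\<lambda>x. - int (snd x)) (\<lambda>x. - int (fst x)) (\<lambda>x. level_Pos k (T x))"
proof
  show "finite Y" using Y by (rule skew_finite)
next
  fix x y :: box
  assume "- int (snd x) = - int (snd y)" "- int (fst x) = - int (fst y)"
  then show "x = y" by (simp add: prod_eq_iff)
next
  fix x y assume "x \<in> Y" "y \<in> Y" "- int (snd x) \<le> - int (snd y)" "- int (fst x) \<le> - int (fst y)"
  then have "(fst y, snd x) \<in> Y" "(fst x, snd y) \<in> Y"
    using skew_corners[OF Y, of "fst y" "snd y" "fst x" "snd x"] by auto
  then show "\<exists>z\<in>Y. - int (snd z) = - int (snd y) \<and> - int (fst z) = - int (fst x)"
    "\<exists>z\<in>Y. - int (snd z) = - int (snd x) \<and> - int (fst z) = - int (fst y)"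
    by (auto intro: bexI[rotated])
next
  fix x y assume "x \<in> Y" "y \<in> Y" "- int (snd x) = - int (snd y)" "- int (fst x) < - int (fst y)"
  then have "T y \<le> T x"
    using tableau_column(1)[OF T, of "fst y" "snd y" "fst x"] by (cases x; cases y) auto
  then show "level_Pos k (T x) \<le> level_Pos k (T y)" by (rule level_Pos_mono)
next
  fix x y assume "x \<in> Y" "y \<in> Y" "- int (fst x) = - int (fst y)" "- int (snd x) < - int (snd y)"
  then have "T y \<le> T x" "T y = T x \<Longrightarrow> T y \<in> letters_plus m"
    using tableau_row[OF T, of "fst y" "snd y" "snd x"] by (cases x; cases y; simp)+
  then show "level_Pos k (T x) < level_Pos k (T y) \<or>
      level_Pos k (T x) = level_Pos k (T y) \<and> level_Pos k (T x) \<notin> {0, 1}"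
    using level_Pos_strict[of "T y" "T x" k] level_Pos_letters_plus[of "T y" m k] k
    by (cases "T x = T y") (auto simp: order_less_le)
qed

text \<open>A changed entry could violate semistandardness only against an equal letter in its row or the other of
  the two letters in its column. The former is excluded by \<open>pivot_row_right\<close> and \<open>pivot_row_left\<close>, the latter because
  a pivot has no partner.\<close>

lemma lifts_IBar:
  assumes Y: "skew_young_diagram Y" and T: "T \<in> semistandard_tableaux m n Y" and k: "1 \<le> k" "k < m"
  shows "lifts m n Y T (ftil (tensor_power m n (card Y)) (IBar k))"
    and "lifts m n Y T (etil (tensor_power m n (card Y)) (IBar k))"
proof -
  let ?row = "\<lambda>x::box. int (fst x)" and ?col = "\<lambda>x::box. int (snd x)"
  let ?level = "\<lambda>x. level_Bar k (T x)"
  let ?a = "Bar (Suc k)" and ?b = "Bar k"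
  interpret level_filling Y ?row ?col ?level by (rule level_filling_Bar[OF Y T k(1)])
  have higher: "higher x y \<longleftrightarrow> strictly_higher x y" for x y
    by (cases x; cases y) (auto simp: higher_def)
  have lev: "level_Bar k c = 0 \<longleftrightarrow> c = ?a" "level_Bar k c = 1 \<longleftrightarrow> c = ?b" for c
    by (cases c; force)+
  have charge: "charge x = sign ?a ?b (T x)" for x
    by (simp add: charge_def sign_def lev)
  have ab: "?a \<noteq> ?b" by simp
  have in_letters: "?a \<in> letters m n" "?b \<in> letters m n" "?a \<in> letters_plus m" "?b \<in> letters_plus m"
    using k by (auto simp: letters_def letters_plus_def)
  have not_minus: "Bar j \<notin> letters_minus n" for j by (auto simp: letters_minus_def)
  have below_b: "c < ?b" if "c \<le> ?a" for c
    using that by (cases c) (auto simp: less_letter_def)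
  have above_a: "?a < c" if "?b \<le> c" for c
    using that by (cases c) (auto simp: less_letter_def)
  have from_a: "?b < c \<or> c = ?b" if "?a \<le> c" "c \<noteq> ?a" for c
    using that by (cases c) (auto simp: less_letter_def)
  have to_b: "c < ?a \<or> c = ?a" if "c \<le> ?b" "c \<noteq> ?b" for c
    using that by (cases c) (auto simp: less_letter_def)
  show "lifts m n Y T (ftil (tensor_power m n (card Y)) (IBar k))"
  proof (rule lifts_flip(1)[OF level_filling_axioms higher ab charge])
    show "ftil (tensor_power m n (card Y)) (IBar k) w = Some y \<longleftrightarrow> flip ?a ?b w y"
      if "length w = card Y" for w y using tensor_power_IBar[OF k that] by blast
    fix x assume x: "pivot x" "x \<in> Y" "T x = ?a"
    obtain i j where ij: "x = (i, j)" by (cases x)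
    note x' = x[unfolded ij]
    have lx: "?level (i, j) = 0" using x'(3) lev by simp
    show "T(x := ?b) \<in> semistandard_tableaux m n Y"
      unfolding ij
    proof (rule tableau_update[OF T x'(2) in_letters(2)])
      fix j' assume j': "(i, j') \<in> Y" "j' < j"
      have "T (i, j') \<le> ?a" using tableau_row(1)[OF T j'(1) x'(2) j'(2)] x'(3) by simp
      from below_b[OF this] show "T (i, j') < ?b \<or> T (i, j') = ?b \<and> ?b \<in> letters_plus m"
        by blast
    next
      fix j' assume j': "(i, j') \<in> Y" "j < j'"
      have ne: "T (i, j') \<noteq> ?a" using pivot_row_right[OF x'(1) lx j'(1)] j'(2) lev by simp
      have "?a \<le> T (i, j')" using tableau_row(1)[OF T x'(2) j'] x'(3) by simp
      from from_a[OF this ne] show "?b < T (i, j') \<or> T (i, j') = ?b \<and> ?b \<in> letters_plus m"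
        using in_letters by blast
    next
      fix i' assume i': "(i', j) \<in> Y" "i' < i"
      have "T (i', j) \<le> ?a" using tableau_column(1)[OF T i'(1) x'(2) i'(2)] x'(3) by simp
      from below_b[OF this] show "T (i', j) < ?b \<or> T (i', j) = ?b \<and> ?b \<in> letters_minus n"
        by blast
    next
      fix i' assume i': "(i', j) \<in> Y" "i < i'"
      have ne': "T (i', j) \<noteq> ?b" using pivot_column[OF x'(1) i'(1)] i'(2) lev by simp
      have ne: "T (i', j) \<noteq> ?a" using tableau_column(2)[OF T x'(2) i'] x'(3) not_minus by auto
      have "?a \<le> T (i', j)" using tableau_column(1)[OF T x'(2) i'] x'(3) by simp
      from from_a[OF this ne] show "?b < T (i', j) \<or> T (i', j) = ?b \<and> ?b \<in> letters_minus n"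
        using ne' by blast
    qed
  qed
  show "lifts m n Y T (etil (tensor_power m n (card Y)) (IBar k))"
  proof (rule lifts_flip(2)[OF level_filling_axioms higher ab charge])
    show "etil (tensor_power m n (card Y)) (IBar k) w = Some y \<longleftrightarrow> flip ?a ?b y w"
      if "length w = card Y" for w y using tensor_power_IBar[OF k that] by blast
    fix x assume x: "pivot x" "x \<in> Y" "T x = ?b"
    obtain i j where ij: "x = (i, j)" by (cases x)
    note x' = x[unfolded ij]
    have lx: "?level (i, j) = 1" using x'(3) lev by simp
    show "T(x := ?a) \<in> semistandard_tableaux m n Y"
      unfolding ij
    proof (rule tableau_update[OF T x'(2) in_letters(1)])
      fix j' assume j': "(i, j') \<in> Y" "j' < j"
      have ne: "T (i, j') \<noteq> ?b" using pivot_row_left[OF x'(1) lx j'(1)] j'(2) lev by simp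
      have "T (i, j') \<le> ?b" using tableau_row(1)[OF T j'(1) x'(2) j'(2)] x'(3) by simp
      from to_b[OF this ne] show "T (i, j') < ?a \<or> T (i, j') = ?a \<and> ?a \<in> letters_plus m"
        using in_letters by blast
    next
      fix j' assume j': "(i, j') \<in> Y" "j < j'"
      have "?b \<le> T (i, j')" using tableau_row(1)[OF T x'(2) j'] x'(3) by simp
      from above_a[OF this] show "?a < T (i, j') \<or> T (i, j') = ?a \<and> ?a \<in> letters_plus m"
        by blast
    next
      fix i' assume i': "(i', j) \<in> Y" "i' < i"
      have ne': "T (i', j) \<noteq> ?a" using pivot_column[OF x'(1) i'(1)] i'(2) lev by simp
      have ne: "T (i', j) \<noteq> ?b" using tableau_column(2)[OF T i'(1) x'(2) i'(2)] x'(3) not_minus by auto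
      have "T (i', j) \<le> ?b" using tableau_column(1)[OF T i'(1) x'(2) i'(2)] x'(3) by simp
      from to_b[OF this ne] show "T (i', j) < ?a \<or> T (i', j) = ?a \<and> ?a \<in> letters_minus n"
        using ne' by blast
    next
      fix i' assume i': "(i', j) \<in> Y" "i < i'"
      have "?b \<le> T (i', j)" using tableau_column(1)[OF T x'(2) i'] x'(3) by simp
      from above_a[OF this] show "?a < T (i', j) \<or> T (i', j) = ?a \<and> ?a \<in> letters_minus n"
        by blast
    qed
  qed
qed

lemma lifts_IPos:
  assumes Y: "skew_young_diagram Y" and T: "T \<in> semistandard_tableaux m n Y" and k: "1 \<le> k" "k < n"
  shows "lifts m n Y T (etil (tensor_power m n (card Y)) (IPos k))"
    and "lifts m n Y T (ftil (tensor_power m n (card Y)) (IPos k))"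
proof -
  let ?row = "\<lambda>x::box. - int (snd x)" and ?col = "\<lambda>x::box. - int (fst x)"
  let ?level = "\<lambda>x. level_Pos k (T x)"
  let ?a = "Pos (Suc k)" and ?b = "Pos k"
  interpret level_filling Y ?row ?col ?level by (rule level_filling_Pos[OF Y T k(1)])
  have higher: "higher x y \<longleftrightarrow> strictly_higher x y" for x y
    by (cases x; cases y) (auto simp: higher_def)
  have lev: "level_Pos k c = 0 \<longleftrightarrow> c = ?a" "level_Pos k c = 1 \<longleftrightarrow> c = ?b" for c
    by (cases c; force)+
  have charge: "charge x = sign ?a ?b (T x)" for x
    by (simp add: charge_def sign_def lev)
  have ab: "?a \<noteq> ?b" by simp
  have in_letters: "?a \<in> letters m n" "?b \<in> letters m n" "?a \<in> letters_minus n" "?b \<in> letters_minus n"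
    using k by (auto simp: letters_def letters_minus_def)
  have not_plus: "Pos j \<notin> letters_plus m" for j by (auto simp: letters_plus_def)
  have above_b: "?b < c" if "?a \<le> c" for c
    using that by (cases c) (auto simp: less_letter_def)
  have below_a: "c < ?a" if "c \<le> ?b" for c
    using that by (cases c) (auto simp: less_letter_def)
  have to_a: "c < ?b \<or> c = ?b" if "c \<le> ?a" "c \<noteq> ?a" for c
    using that by (cases c) (auto simp: less_letter_def)
  have from_b: "?a < c \<or> c = ?a" if "?b \<le> c" "c \<noteq> ?b" for c
    using that by (cases c) (auto simp: less_letter_def)
  show "lifts m n Y T (etil (tensor_power m n (card Y)) (IPos k))"
  proof (rule lifts_flip(1)[OF level_filling_axioms higher ab charge])
    show "etil (tensor_power m n (card Y)) (IPos k) w = Some y \<longleftrightarrow> flip ?a ?b w y"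
      if "length w = card Y" for w y using tensor_power_IPos[OF k that] by blast
    fix x assume x: "pivot x" "x \<in> Y" "T x = ?a"
    obtain i j where ij: "x = (i, j)" by (cases x)
    note x' = x[unfolded ij]
    have lx: "?level (i, j) = 0" using x'(3) lev by simp
    show "T(x := ?b) \<in> semistandard_tableaux m n Y"
      unfolding ij
    proof (rule tableau_update[OF T x'(2) in_letters(2)])
      fix j' assume j': "(i, j') \<in> Y" "j' < j"
      have ne': "T (i, j') \<noteq> ?b" using pivot_column[OF x'(1) j'(1)] j'(2) lev by simp
      have ne: "T (i, j') \<noteq> ?a" using tableau_row(2)[OF T j'(1) x'(2) j'(2)] x'(3) not_plus by auto
      have "T (i, j') \<le> ?a" using tableau_row(1)[OF T j'(1) x'(2) j'(2)] x'(3) by simp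
      from to_a[OF this ne] show "T (i, j') < ?b \<or> T (i, j') = ?b \<and> ?b \<in> letters_plus m"
        using ne' by blast
    next
      fix j' assume j': "(i, j') \<in> Y" "j < j'"
      have "?a \<le> T (i, j')" using tableau_row(1)[OF T x'(2) j'] x'(3) by simp
      from above_b[OF this] show "?b < T (i, j') \<or> T (i, j') = ?b \<and> ?b \<in> letters_plus m"
        by blast
    next
      fix i' assume i': "(i', j) \<in> Y" "i' < i"
      have ne: "T (i', j) \<noteq> ?a" using pivot_row_right[OF x'(1) lx i'(1)] i'(2) lev by simp
      have "T (i', j) \<le> ?a" using tableau_column(1)[OF T i'(1) x'(2) i'(2)] x'(3) by simp
      from to_a[OF this ne] show "T (i', j) < ?b \<or> T (i', j) = ?b \<and> ?b \<in> letters_minus n"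
        using in_letters by blast
    next
      fix i' assume i': "(i', j) \<in> Y" "i < i'"
      have "?a \<le> T (i', j)" using tableau_column(1)[OF T x'(2) i'] x'(3) by simp
      from above_b[OF this] show "?b < T (i', j) \<or> T (i', j) = ?b \<and> ?b \<in> letters_minus n"
        by blast
    qed
  qed
  show "lifts m n Y T (ftil (tensor_power m n (card Y)) (IPos k))"
  proof (rule lifts_flip(2)[OF level_filling_axioms higher ab charge])
    show "ftil (tensor_power m n (card Y)) (IPos k) w = Some y \<longleftrightarrow> flip ?a ?b y w"
      if "length w = card Y" for w y using tensor_power_IPos[OF k that] by blast
    fix x assume x: "pivot x" "x \<in> Y" "T x = ?b"
    obtain i j where ij: "x = (i, j)" by (cases x)
    note x' = x[unfolded ij]
    have lx: "?level (i, j) = 1" using x'(3) lev by simp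
    show "T(x := ?a) \<in> semistandard_tableaux m n Y"
      unfolding ij
    proof (rule tableau_update[OF T x'(2) in_letters(1)])
      fix j' assume j': "(i, j') \<in> Y" "j' < j"
      have "T (i, j') \<le> ?b" using tableau_row(1)[OF T j'(1) x'(2) j'(2)] x'(3) by simp
      from below_a[OF this] show "T (i, j') < ?a \<or> T (i, j') = ?a \<and> ?a \<in> letters_plus m"
        by blast
    next
      fix j' assume j': "(i, j') \<in> Y" "j < j'"
      have ne': "T (i, j') \<noteq> ?a" using pivot_column[OF x'(1) j'(1)] j'(2) lev by simp
      have ne: "T (i, j') \<noteq> ?b" using tableau_row(2)[OF T x'(2) j'] x'(3) not_plus by auto
      have "?b \<le> T (i, j')" using tableau_row(1)[OF T x'(2) j'] x'(3) by simp
      from from_b[OF this ne] show "?a < T (i, j') \<or> T (i, j') = ?a \<and> ?a \<in> letters_plus m"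
        using ne' by blast
    next
      fix i' assume i': "(i', j) \<in> Y" "i' < i"
      have "T (i', j) \<le> ?b" using tableau_column(1)[OF T i'(1) x'(2) i'(2)] x'(3) by simp
      from below_a[OF this] show "T (i', j) < ?a \<or> T (i', j) = ?a \<and> ?a \<in> letters_minus n"
        by blast
    next
      fix i' assume i': "(i', j) \<in> Y" "i < i'"
      have ne: "T (i', j) \<noteq> ?b" using pivot_row_left[OF x'(1) lx i'(1)] i'(2) lev by simp
      have "?b \<le> T (i', j)" using tableau_column(1)[OF T x'(2) i'] x'(3) by simp
      from from_b[OF this ne] show "?a < T (i', j) \<or> T (i', j) = ?a \<and> ?a \<in> letters_minus n"
        using in_letters by blast
    qed
  qed
qed

text \<open>The box that decides at the index \<open>0\<close>: it is read before all others with entry \<open>Bar 1\<close> or \<open>Pos 1\<close>.\<close>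

definition summit :: "box set \<Rightarrow> tableau \<Rightarrow> box \<Rightarrow> bool" where
  "summit Y T x \<longleftrightarrow> T x \<in> {Bar 1, Pos 1} \<and>
     (\<forall>y\<in>Y. T y \<in> {Bar 1, Pos 1} \<and> y \<noteq> x \<longrightarrow> strictly_higher x y)"

lemma between_Bar1_Pos1:
  "x \<in> letters m n \<Longrightarrow> a \<le> x \<Longrightarrow> x \<le> b \<Longrightarrow> a \<in> {Bar 1, Pos 1} \<Longrightarrow> b \<in> {Bar 1, Pos 1} \<Longrightarrow>
    x \<in> {Bar 1, Pos 1}"
  by (cases x) (auto simp: letters_def letters_plus_def letters_minus_def)

text \<open>Were the first relevant box not strictly higher than some other one, the two would be opposite corners
  of a rectangle whose north-east corner has an entry between theirs. That corner would then be relevant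
  and read earlier than both.\<close>

lemma summit_iff_first:
  assumes Y: "skew_young_diagram Y" and T: "T \<in> semistandard_tableaux m n Y"
    and xs: "listing Y xs" "admissible xs" and p: "p < length xs" "T (xs ! p) \<in> {Bar 1, Pos 1}"
  shows "set (take p (map T xs)) \<inter> {Bar 1, Pos 1} = {} \<longleftrightarrow> summit Y T (xs ! p)"
proof -
  have set_xs: "set xs = Y" and dist: "distinct xs" using xs(1) by (auto simp: listing_def)
  have less: "r < s" if "r < length xs" "s < length xs" "strictly_higher (xs ! r) (xs ! s)" for r s
    using xs(2) that unfolding admissible_def by blast
  have in_Y: "xs ! s \<in> Y" if "s < length xs" for s using nth_mem[OF that] set_xs by simp
  have first: "set (take p (map T xs)) \<inter> {Bar 1, Pos 1} = {} \<longleftrightarrow> (\<forall>q<p. T (xs ! q) \<notin> {Bar 1, Pos 1})"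
    (is "?F \<longleftrightarrow> ?Q")
  proof -
    have "set (take p (map T xs)) = (\<lambda>q. T (xs ! q)) ` {..<p}"
      unfolding take_map set_map nth_image[OF less_imp_le[OF p(1)], symmetric]
        image_image atLeast0LessThan by (rule refl)
    then show ?thesis by (simp only:) blast
  qed
  show ?thesis
    unfolding first
  proof
    assume Q: ?Q
    (* whatever is strictly higher than the first relevant box is read earlier, hence irrelevant *)
    have no_higher: "T z \<notin> {Bar 1, Pos 1}" if z: "z \<in> Y" "strictly_higher z (xs ! p)" for z
    proof -
      obtain s where s: "s < length xs" "z = xs ! s"
        using z(1) unfolding set_xs[symmetric] in_set_conv_nth by blast
      then have "s < p" using less[OF s(1) p(1)] z(2) by simp
      with Q have "T (xs ! s) \<notin> {Bar 1, Pos 1}" by blast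
      then show ?thesis unfolding s(2) .
    qed
    obtain i j where ij: "xs ! p = (i, j)" by (cases "xs ! p")
    have x: "(i, j) \<in> Y" "T (i, j) \<in> {Bar 1, Pos 1}" using in_Y[OF p(1)] p(2) ij by simp_all
    have row_le: "T (r, c) \<le> T (r, c')" if "(r, c) \<in> Y" "(r, c') \<in> Y" "c \<le> c'" for r c c'
      using tableau_row(1)[OF T that(1,2)] that(3) by (cases "c = c'") auto
    have column_le: "T (r, c) \<le> T (r', c)" if "(r, c) \<in> Y" "(r', c) \<in> Y" "r \<le> r'" for r r' c
      using tableau_column(1)[OF T that(1,2)] that(3) by (cases "r = r'") auto
    show "summit Y T (xs ! p)"
      unfolding summit_def
    proof (intro conjI p(2) ballI impI, rule ccontr)
      fix y assume y: "y \<in> Y" "T y \<in> {Bar 1, Pos 1} \<and> y \<noteq> xs ! p" "\<not> strictly_higher (xs ! p) y"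
      obtain i' j' where y': "y = (i', j')" by (cases y)
      have yY: "(i', j') \<in> Y" and Ty: "T (i', j') \<in> {Bar 1, Pos 1}" using y(1,2) y' by simp_all
      have "\<not> strictly_higher y (xs ! p)" using no_higher[OF y(1)] y(2) by blast
      then have "\<not> (i' \<le> i \<and> j \<le> j')" "\<not> (i \<le> i' \<and> j' \<le> j)"
        using y(2,3) unfolding y' ij by auto
      then consider "i < i'" "j < j'" | "i' < i" "j' < j" by linarith
      then show False
      proof cases
        case 1
        then have c: "(i, j') \<in> Y" using skew_corners(2)[OF Y x(1) yY] by simp
        have "T (i, j) \<le> T (i, j')" by (rule row_le[OF x(1) c]) (use 1 in simp)
        moreover have "T (i, j') \<le> T (i', j')" by (rule column_le[OF c yY]) (use 1 in simp)
        ultimately have "T (i, j') \<in> {Bar 1, Pos 1}"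
          by (rule between_Bar1_Pos1[OF tableau_in_letters[OF T c] _ _ x(2) Ty])
        moreover have "strictly_higher (i, j') (xs ! p)" using 1 ij by simp
        ultimately show False using no_higher[OF c] by blast
      next
        case 2
        then have c: "(i', j) \<in> Y" using skew_corners(2)[OF Y yY x(1)] by simp
        have "T (i', j') \<le> T (i', j)" by (rule row_le[OF yY c]) (use 2 in simp)
        moreover have "T (i', j) \<le> T (i, j)" by (rule column_le[OF c x(1)]) (use 2 in simp)
        ultimately have "T (i', j) \<in> {Bar 1, Pos 1}"
          by (rule between_Bar1_Pos1[OF tableau_in_letters[OF T c] _ _ Ty x(2)])
        moreover have "strictly_higher (i', j) (xs ! p)" using 2 ij by simp
        ultimately show False using no_higher[OF c] by blast
      qed
    qed
  next
    assume top: "summit Y T (xs ! p)"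
    show ?Q
    proof (intro allI impI notI)
      fix q assume q: "q < p" "T (xs ! q) \<in> {Bar 1, Pos 1}"
      then have "xs ! q \<noteq> xs ! p" using dist p(1) by (simp add: nth_eq_iff_index_eq)
      then have "strictly_higher (xs ! p) (xs ! q)"
        using top q in_Y[of q] p(1) by (simp add: summit_def)
      then have "p < q" using less[OF p(1)] q(1) p(1) by simp
      with q show False by simp
    qed
  qed
qed

lemma lifts_IZero:
  assumes mn: "1 \<le> m" "1 \<le> n" and Y: "skew_young_diagram Y" and T: "T \<in> semistandard_tableaux m n Y"
  shows "lifts m n Y T (ftil (tensor_power m n (card Y)) IZero)"
    and "lifts m n Y T (etil (tensor_power m n (card Y)) IZero)"
proof -
  have in_letters: "Bar 1 \<in> letters m n" "Pos 1 \<in> letters m n"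
    "Bar 1 \<in> letters_plus m" "Pos 1 \<in> letters_minus n"
    using mn by (auto simp: letters_def letters_plus_def letters_minus_def)
  have not: "Bar 1 \<notin> letters_minus n" "Pos 1 \<notin> letters_plus m"
    by (auto simp: letters_plus_def letters_minus_def)
  have ball: "(\<exists>x\<in>Y. P x) \<longleftrightarrow> (\<exists>p<length xs. P (xs ! p))" if "listing Y xs" for P xs
  proof -
    have "Y = (!) xs ` {..<length xs}" using that by (auto simp: listing_def set_conv_nth image_def)
    then show ?thesis by blast
  qed
  have below_Pos: "c < Pos 1" if "c \<le> Bar 1" for c
    using that by (cases c) (auto simp: less_letter_def)
  have above_Bar: "Bar 1 < c" if "Pos 1 \<le> c" for c
    using that by (cases c) (auto simp: less_letter_def)
  have above_Pos: "Pos 1 < c" if "c \<in> letters m n" "Bar 1 \<le> c" "c \<notin> {Bar 1, Pos 1}" for c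
    using that by (cases c) (auto simp: less_letter_def letters_def letters_plus_def letters_minus_def)
  have below_Bar: "c < Bar 1" if "c \<in> letters m n" "c \<le> Pos 1" "c \<notin> {Bar 1, Pos 1}" for c
    using that by (cases c) (auto simp: less_letter_def letters_def letters_plus_def letters_minus_def)
  have right: "T (i, j') \<notin> {Bar 1, Pos 1}" if "summit Y T (i, j)" "(i, j') \<in> Y" "j < j'" for i j j'
    using that by (force simp: summit_def)
  have above: "T (i', j) \<notin> {Bar 1, Pos 1}" if "summit Y T (i, j)" "(i', j) \<in> Y" "i' < i" for i i' j
    using that by (force simp: summit_def)
  show "lifts m n Y T (ftil (tensor_power m n (card Y)) IZero)"
  proof (rule lifts_replace[where P = "\<lambda>x. summit Y T x \<and> T x = Bar 1" and c = "Pos 1"])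
    fix xs w assume xs: "listing Y xs" "admissible xs"
    then have dist: "distinct xs" and len: "length (map T xs) = card Y"
      using listing_length by (auto simp: listing_def)
    have "flip_first (map T xs) w \<longleftrightarrow>
        (\<exists>p<length xs. (summit Y T (xs ! p) \<and> T (xs ! p) = Bar 1) \<and> w = map (T(xs ! p := Pos 1)) xs)"
      unfolding flip_first_left_iff_nth length_map
    proof (rule ex_cong1, rule conj_cong[OF refl])
      fix p assume p: "p < length xs"
      show "(map T xs ! p = Bar 1 \<and> w = (map T xs)[p := Pos 1] \<and>
          set (take p (map T xs)) \<inter> {Bar 1, Pos 1} = {}) \<longleftrightarrow>
        ((summit Y T (xs ! p) \<and> T (xs ! p) = Bar 1) \<and> w = map (T(xs ! p := Pos 1)) xs)"
        using summit_iff_first[OF Y T xs p] nth_map[OF p, of T]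
        unfolding map_update_distinct[OF dist p, of T "Pos 1"] by auto
    qed
    then show "ftil (tensor_power m n (card Y)) IZero (map T xs) = Some w \<longleftrightarrow>
        (\<exists>x\<in>Y. (summit Y T x \<and> T x = Bar 1) \<and> w = map (T(x := Pos 1)) xs)"
      using tensor_power_IZero[OF len, of m n w] ball[OF xs(1)] by simp
  next
    fix x assume x: "x \<in> Y" "summit Y T x \<and> T x = Bar 1"
    obtain i j where ij: "x = (i, j)" by (cases x)
    have x': "(i, j) \<in> Y" "summit Y T (i, j)" "T (i, j) = Bar 1" using x ij by auto
    show "T(x := Pos 1) \<in> semistandard_tableaux m n Y"
      unfolding ij
    proof (rule tableau_update[OF T x'(1) in_letters(2)])
      fix j' assume j': "(i, j') \<in> Y" "j' < j"
      have "T (i, j') \<le> Bar 1" using tableau_row(1)[OF T j'(1) x'(1) j'(2)] x'(3) by simp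
      from below_Pos[OF this] show "T (i, j') < Pos 1 \<or> T (i, j') = Pos 1 \<and> Pos 1 \<in> letters_plus m"
        by blast
    next
      fix j' assume j': "(i, j') \<in> Y" "j < j'"
      have "Bar 1 \<le> T (i, j')" using tableau_row(1)[OF T x'(1) j'] x'(3) by simp
      from above_Pos[OF tableau_in_letters[OF T j'(1)] this right[OF x'(2) j']]
      show "Pos 1 < T (i, j') \<or> T (i, j') = Pos 1 \<and> Pos 1 \<in> letters_plus m" by blast
    next
      fix i' assume i': "(i', j) \<in> Y" "i' < i"
      have "T (i', j) \<le> Bar 1" using tableau_column(1)[OF T i'(1) x'(1) i'(2)] x'(3) by simp
      from below_Pos[OF this] show "T (i', j) < Pos 1 \<or> T (i', j) = Pos 1 \<and> Pos 1 \<in> letters_minus n"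
        by blast
    next
      fix i' assume i': "(i', j) \<in> Y" "i < i'"
      have le: "Bar 1 \<le> T (i', j)" using tableau_column(1)[OF T x'(1) i'] x'(3) by simp
      have ne: "T (i', j) \<noteq> Bar 1" using tableau_column(2)[OF T x'(1) i'] x'(3) not by auto
      show "Pos 1 < T (i', j) \<or> T (i', j) = Pos 1 \<and> Pos 1 \<in> letters_minus n"
        using above_Pos[OF tableau_in_letters[OF T i'(1)] le] ne in_letters by blast
    qed
  qed
  show "lifts m n Y T (etil (tensor_power m n (card Y)) IZero)"
  proof (rule lifts_replace[where P = "\<lambda>x. summit Y T x \<and> T x = Pos 1" and c = "Bar 1"])
    fix xs w assume xs: "listing Y xs" "admissible xs"
    then have dist: "distinct xs" and len: "length (map T xs) = card Y"
      using listing_length by (auto simp: listing_def)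
    have "flip_first w (map T xs) \<longleftrightarrow>
        (\<exists>p<length xs. (summit Y T (xs ! p) \<and> T (xs ! p) = Pos 1) \<and> w = map (T(xs ! p := Bar 1)) xs)"
      unfolding flip_first_right_iff_nth length_map
    proof (rule ex_cong1, rule conj_cong[OF refl])
      fix p assume p: "p < length xs"
      show "(map T xs ! p = Pos 1 \<and> w = (map T xs)[p := Bar 1] \<and>
          set (take p (map T xs)) \<inter> {Bar 1, Pos 1} = {}) \<longleftrightarrow>
        ((summit Y T (xs ! p) \<and> T (xs ! p) = Pos 1) \<and> w = map (T(xs ! p := Bar 1)) xs)"
        using summit_iff_first[OF Y T xs p] nth_map[OF p, of T]
        unfolding map_update_distinct[OF dist p, of T "Bar 1"] by auto
    qed
    then show "etil (tensor_power m n (card Y)) IZero (map T xs) = Some w \<longleftrightarrow>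
        (\<exists>x\<in>Y. (summit Y T x \<and> T x = Pos 1) \<and> w = map (T(x := Bar 1)) xs)"
      using tensor_power_IZero[OF len, of m n w] ball[OF xs(1)] by simp
  next
    fix x assume x: "x \<in> Y" "summit Y T x \<and> T x = Pos 1"
    obtain i j where ij: "x = (i, j)" by (cases x)
    have x': "(i, j) \<in> Y" "summit Y T (i, j)" "T (i, j) = Pos 1" using x ij by auto
    show "T(x := Bar 1) \<in> semistandard_tableaux m n Y"
      unfolding ij
    proof (rule tableau_update[OF T x'(1) in_letters(1)])
      fix j' assume j': "(i, j') \<in> Y" "j' < j"
      have le: "T (i, j') \<le> Pos 1" using tableau_row(1)[OF T j'(1) x'(1) j'(2)] x'(3) by simp
      have ne: "T (i, j') \<noteq> Pos 1" using tableau_row(2)[OF T j'(1) x'(1) j'(2)] x'(3) not by auto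
      show "T (i, j') < Bar 1 \<or> T (i, j') = Bar 1 \<and> Bar 1 \<in> letters_plus m"
        using below_Bar[OF tableau_in_letters[OF T j'(1)] le] ne in_letters by blast
    next
      fix j' assume j': "(i, j') \<in> Y" "j < j'"
      have "Pos 1 \<le> T (i, j')" using tableau_row(1)[OF T x'(1) j'] x'(3) by simp
      from above_Bar[OF this] show "Bar 1 < T (i, j') \<or> T (i, j') = Bar 1 \<and> Bar 1 \<in> letters_plus m"
        by blast
    next
      fix i' assume i': "(i', j) \<in> Y" "i' < i"
      have "T (i', j) \<le> Pos 1" using tableau_column(1)[OF T i'(1) x'(1) i'(2)] x'(3) by simp
      from below_Bar[OF tableau_in_letters[OF T i'(1)] this above[OF x'(2) i']]
      show "T (i', j) < Bar 1 \<or> T (i', j) = Bar 1 \<and> Bar 1 \<in> letters_minus n" by blast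
    next
      fix i' assume i': "(i', j) \<in> Y" "i < i'"
      have "Pos 1 \<le> T (i', j)" using tableau_column(1)[OF T x'(1) i'] x'(3) by simp
      from above_Bar[OF this] show "Bar 1 < T (i', j) \<or> T (i', j) = Bar 1 \<and> Bar 1 \<in> letters_minus n"
        by blast
    qed
  qed
qed

lemma lifts_crystal_operators:
  assumes "1 \<le> m" "1 \<le> n" "skew_young_diagram Y" "T \<in> semistandard_tableaux m n Y" "i \<in> indices m n"
  shows "lifts m n Y T (etil (tensor_power m n (card Y)) i)"
    and "lifts m n Y T (ftil (tensor_power m n (card Y)) i)"
proof -
  consider k where "i = IBar k" "1 \<le> k" "k < m" | "i = IZero" | k where "i = IPos k" "1 \<le> k" "k < n"
    using assms(5) by (auto simp: indices_def)
  then show "lifts m n Y T (etil (tensor_power m n (card Y)) i)"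
    "lifts m n Y T (ftil (tensor_power m n (card Y)) i)"
    using lifts_IBar[OF assms(3,4)] lifts_IZero[OF assms(1-4)] lifts_IPos[OF assms(3,4)]
    by (cases; simp)+
qed

section \<open>Induced crystals\<close>

context
  fixes A :: "'a set" and \<psi> :: "'a \<Rightarrow> 'b" and C :: "'b crystal" and m n :: nat
  assumes inj: "inj_on \<psi> A" and stable: "stable m n C (\<psi> ` A)"
begin

lemma induced_operator:
  assumes "set_option (g (\<psi> a)) \<subseteq> \<psi> ` A"
  shows "set_option (map_option (inv_into A \<psi>) (g (\<psi> a))) \<subseteq> A"
  using assms by (cases "g (\<psi> a)") (auto simp: inv_into_into)

lemma induced_iter:
  assumes "\<And>a. a \<in> A \<Longrightarrow> set_option (g (\<psi> a)) \<subseteq> \<psi> ` A"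
  shows "a \<in> A \<Longrightarrow> iter (\<lambda>a. map_option (inv_into A \<psi>) (g (\<psi> a))) r a \<noteq> None \<longleftrightarrow> iter g r (\<psi> a) \<noteq> None"
proof (induction r arbitrary: a)
  case 0
  then show ?case by (simp add: iter_0)
next
  case (Suc r)
  show ?case
  proof (cases "g (\<psi> a)")
    case None
    then show ?thesis by (simp add: iter_Suc)
  next
    case (Some b)
    with assms[OF Suc.prems] have "b \<in> \<psi> ` A" by simp
    then have "inv_into A \<psi> b \<in> A" "\<psi> (inv_into A \<psi> b) = b" by (simp_all add: inv_into_into f_inv_into_f)
    with Suc.IH[of "inv_into A \<psi> b"] Some show ?thesis by (simp add: iter_Suc)
  qed
qed

lemma induced_eq_Some:
  assumes "set_option (g (\<psi> a)) \<subseteq> \<psi> ` A" "a' \<in> A"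
  shows "map_option (inv_into A \<psi>) (g (\<psi> a)) = Some a' \<longleftrightarrow> g (\<psi> a) = Some (\<psi> a')"
  using assms inj by (cases "g (\<psi> a)") (auto simp: inv_into_f_f)

text \<open>The axioms are inherited because strings starting in a stable subset stay in it.\<close>

theorem is_crystal_induced:
  assumes C: "is_crystal m n C" and sub: "\<psi> ` A \<subseteq> elts C"
  shows "is_crystal m n (induced_crystal A \<psi> C)"
proof -
  let ?I = "induced_crystal A \<psi> C"
  have stab: "set_option (etil C i (\<psi> a)) \<subseteq> \<psi> ` A" "set_option (ftil C i (\<psi> a)) \<subseteq> \<psi> ` A"
    if "i \<in> indices m n" "a \<in> A" for i a
    using stable that unfolding stable_def by blast+
  have I: "elts ?I = A" "wt ?I a = wt C (\<psi> a)"
    "etil ?I i = (\<lambda>a. map_option (inv_into A \<psi>) (etil C i (\<psi> a)))"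
    "ftil ?I i = (\<lambda>a. map_option (inv_into A \<psi>) (ftil C i (\<psi> a)))" for a i
    by (simp_all add: induced_crystal_def)
  show ?thesis
    unfolding is_crystal_def
  proof (intro conjI ballI)
    fix a assume "a \<in> elts ?I"
    then have a: "a \<in> A" "\<psi> a \<in> elts C" using sub by (auto simp: I)
    show "wt ?I a \<in> weight_lattice m n" "0 \<le> pairing IZero (wt ?I a)"
      using C a(2) unfolding is_crystal_def I by blast+
    fix i assume i: "i \<in> indices m n"
    have e: "{r. iter (etil ?I i) r a \<noteq> None} = {r. iter (etil C i) r (\<psi> a) \<noteq> None}"
      unfolding I(3) by (rule Collect_cong) (rule induced_iter[where g = "etil C i", OF stab(1)[OF i] a(1)])
    have f: "{r. iter (ftil ?I i) r a \<noteq> None} = {r. iter (ftil C i) r (\<psi> a) \<noteq> None}"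
      unfolding I(4) by (rule Collect_cong) (rule induced_iter[where g = "ftil C i", OF stab(2)[OF i] a(1)])
    have Ci: "finite {r. iter (etil C i) r (\<psi> a) \<noteq> None}" "finite {r. iter (ftil C i) r (\<psi> a) \<noteq> None}"
      "i \<noteq> IZero \<longrightarrow> int (phi C i (\<psi> a)) - int (epsilon C i (\<psi> a)) = pairing i (wt C (\<psi> a))"
      using C i a(2) unfolding is_crystal_def by blast+
    show "set_option (etil ?I i a) \<subseteq> elts ?I" "set_option (ftil ?I i a) \<subseteq> elts ?I"
      unfolding I using induced_operator stab[OF i a(1)] by blast+
    show "finite {r. iter (etil ?I i) r a \<noteq> None}" unfolding e by (rule Ci(1))
    show "finite {r. iter (ftil ?I i) r a \<noteq> None}" unfolding f by (rule Ci(2))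
    show "i \<noteq> IZero \<longrightarrow> int (phi ?I i a) - int (epsilon ?I i a) = pairing i (wt ?I a)"
      using Ci(3) unfolding phi_def epsilon_def e f I(2) .
    fix a' assume "a' \<in> elts ?I"
    then have a': "a' \<in> A" "\<psi> a' \<in> elts C" using sub by (auto simp: I)
    have Ci': "ftil C i (\<psi> a) = Some (\<psi> a') \<longleftrightarrow> etil C i (\<psi> a') = Some (\<psi> a)"
      "ftil C i (\<psi> a) = Some (\<psi> a') \<longrightarrow> wt C (\<psi> a') = (\<lambda>c. wt C (\<psi> a) c - root i c)"
      using C i a(2) a'(2) unfolding is_crystal_def by blast+
    have fI: "ftil ?I i a = Some a' \<longleftrightarrow> ftil C i (\<psi> a) = Some (\<psi> a')"
      unfolding I by (rule induced_eq_Some[where g = "ftil C i", OF stab(2)[OF i a(1)] a'(1)])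
    have eI: "etil ?I i a' = Some a \<longleftrightarrow> etil C i (\<psi> a') = Some (\<psi> a)"
      unfolding I by (rule induced_eq_Some[where g = "etil C i", OF stab(1)[OF i a'(1)] a(1)])
    show "ftil ?I i a = Some a' \<longleftrightarrow> etil ?I i a' = Some a"
      unfolding fI eI by (rule Ci'(1))
    show "ftil ?I i a = Some a' \<longrightarrow> wt ?I a' = (\<lambda>c. wt ?I a c - root i c)"
      unfolding fI I(2) by (rule Ci'(2))
  qed
qed

end

section \<open>Admissible readings\<close>

lemma reading_inj:
  assumes "listing Y xs"
  shows "inj_on (reading xs) (semistandard_tableaux m n Y)"
proof (rule inj_onI)
  fix T U assume T: "T \<in> semistandard_tableaux m n Y" and U: "U \<in> semistandard_tableaux m n Y"
    and eq: "reading xs T = reading xs U"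
  have "T x = U x" if "x \<in> Y" for x
    using eq that assms by (auto simp: reading_def listing_def)
  moreover have "T \<in> extensional Y" "U \<in> extensional Y"
    using T U by (auto simp: semistandard_tableaux_def PiE_iff)
  ultimately show "T = U" by (intro extensionalityI)
qed

lemma count_list_reading:
  "distinct xs \<Longrightarrow> count_list (map T xs) c = card {x \<in> set xs. T x = c}"
proof (induction xs)
  case (Cons x xs)
  have "{y \<in> set (x # xs). T y = c} =
      (if T x = c then insert x {y \<in> set xs. T y = c} else {y \<in> set xs. T y = c})" by auto
  with Cons show ?case by simp
qed simp

lemma reading_in_tensor_power:
  assumes "listing Y xs" "T \<in> semistandard_tableaux m n Y"
  shows "reading xs T \<in> elts (tensor_power m n (card Y))"
  using assms tableau_in_letters[OF assms(2)] listing_length[OF assms(1)]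
  by (auto simp: elts_tensor_power reading_def listing_def)

text \<open>The operators of the induced crystal go back along an inverse of the reading, which recovers the value
  \<open>T'\<close> chosen before the reading.\<close>

lemma lifts_transport:
  assumes "lifts m n Y T g"
  shows "\<exists>T'. set_option T' \<subseteq> semistandard_tableaux m n Y \<and>
    (\<forall>xs. listing Y xs \<and> admissible xs \<longrightarrow>
       set_option (g (reading xs T)) \<subseteq> reading xs ` semistandard_tableaux m n Y \<and>
       map_option (inv_into (semistandard_tableaux m n Y) (reading xs)) (g (reading xs T)) = T')"
proof -
  obtain T' where T': "set_option T' \<subseteq> semistandard_tableaux m n Y"
    "\<And>xs. listing Y xs \<Longrightarrow> admissible xs \<Longrightarrow> g (reading xs T) = map_option (reading xs) T'"
    using assms unfolding lifts_def by blast
  show ?thesis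
    by (rule exI[of _ T']) (use T' reading_inj in \<open>cases T'; auto simp: inv_into_f_f\<close>)
qed

theorem theorem4p4:
  fixes m n N :: nat and Y :: "box set"
  assumes "1 \<le> m" and "1 \<le> n"
    and "skew_young_diagram Y" and "card Y = N"
  shows
    "(\<forall>xs. listing Y xs \<and> admissible xs \<longrightarrow>
        inj_on (reading xs) (semistandard_tableaux m n Y) \<and>
        reading xs ` semistandard_tableaux m n Y \<subseteq> elts (tensor_power m n N) \<and>
        stable m n (tensor_power m n N) (reading xs ` semistandard_tableaux m n Y) \<and>
        is_crystal m n (tableau_crystal m n Y xs)) \<and>
     (\<forall>xs ys. listing Y xs \<and> admissible xs \<and> listing Y ys \<and> admissible ys \<longrightarrow>
        (\<forall>T \<in> semistandard_tableaux m n Y.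
           wt (tableau_crystal m n Y xs) T = wt (tableau_crystal m n Y ys) T \<and>
           (\<forall>i \<in> indices m n.
              etil (tableau_crystal m n Y xs) i T = etil (tableau_crystal m n Y ys) i T \<and>
              ftil (tableau_crystal m n Y xs) i T = ftil (tableau_crystal m n Y ys) i T)))"
proof -
  let ?C = "tensor_power m n N" and ?B = "semistandard_tableaux m n Y"
  note lift = lifts_crystal_operators[OF assms(1-3), unfolded assms(4)]
  have stab: "stable m n ?C (reading xs ` ?B)" if xs: "listing Y xs" "admissible xs" for xs
    unfolding stable_def
  proof (intro ballI conjI)
    fix w i assume "w \<in> reading xs ` ?B" and i: "i \<in> indices m n"
    then obtain T where T: "T \<in> ?B" "w = reading xs T" by blast
    show "set_option (etil ?C i w) \<subseteq> reading xs ` ?B"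
      using lifts_transport[OF lift(1)[OF T(1) i]] xs T(2) by blast
    show "set_option (ftil ?C i w) \<subseteq> reading xs ` ?B"
      using lifts_transport[OF lift(2)[OF T(1) i]] xs T(2) by blast
  qed
  have part_a: "inj_on (reading xs) ?B \<and> reading xs ` ?B \<subseteq> elts ?C \<and> stable m n ?C (reading xs ` ?B) \<and>
      is_crystal m n (tableau_crystal m n Y xs)" if xs: "listing Y xs" "admissible xs" for xs
  proof (intro conjI)
    show inj: "inj_on (reading xs) ?B" by (rule reading_inj[OF xs(1)])
    show sub: "reading xs ` ?B \<subseteq> elts ?C"
      using reading_in_tensor_power[OF xs(1)] unfolding assms(4) by blast
    show "stable m n ?C (reading xs ` ?B)" by (rule stab[OF xs])
    show "is_crystal m n (tableau_crystal m n Y xs)"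
      unfolding tableau_crystal_def assms(4)
      by (rule is_crystal_induced[OF inj stab[OF xs] is_crystal_tensor_power[OF assms(1,2)] sub])
  qed
  have part_b: "wt (tableau_crystal m n Y xs) T = wt (tableau_crystal m n Y ys) T \<and>
      (\<forall>i\<in>indices m n. etil (tableau_crystal m n Y xs) i T = etil (tableau_crystal m n Y ys) i T \<and>
         ftil (tableau_crystal m n Y xs) i T = ftil (tableau_crystal m n Y ys) i T)"
    if xs: "listing Y xs" "admissible xs" and ys: "listing Y ys" "admissible ys" and T: "T \<in> ?B"
    for xs ys T
  proof (intro conjI ballI)
    have "wt (tableau_crystal m n Y zs) T = (\<lambda>c. int (card {x \<in> Y. T x = c}))" if "listing Y zs" for zs
    proof -
      have "set zs = Y" "distinct zs" using that by (auto simp: listing_def)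
      then show ?thesis
        using listing_length[OF that] count_list_reading[of zs T]
        by (simp add: tableau_crystal_def induced_crystal_def reading_def wt_tensor_power)
    qed
    then show "wt (tableau_crystal m n Y xs) T = wt (tableau_crystal m n Y ys) T"
      using xs(1) ys(1) by simp
    fix i assume i: "i \<in> indices m n"
    have op: "etil (tableau_crystal m n Y zs) i T = map_option (inv_into ?B (reading zs)) (etil ?C i (reading zs T))"
      "ftil (tableau_crystal m n Y zs) i T = map_option (inv_into ?B (reading zs)) (ftil ?C i (reading zs T))" for zs
      by (simp_all add: tableau_crystal_def induced_crystal_def assms(4))
    show "etil (tableau_crystal m n Y xs) i T = etil (tableau_crystal m n Y ys) i T"
      unfolding op using lifts_transport[OF lift(1)[OF T i]] xs ys by metis
    show "ftil (tableau_crystal m n Y xs) i T = ftil (tableau_crystal m n Y ys) i T"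
      unfolding op using lifts_transport[OF lift(2)[OF T i]] xs ys by metis
  qed
  from part_a part_b show ?thesis by blast
qed

end
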